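(* Let $n\ge 1$ and let $A:\mathbb{R}\to\mathcal{L}(\mathbb{R}^n)$ be of locally bounded variation, such that the matrices $I-\Delta^{-}A(t)$ and $I+\Delta^{+}A(t)$ are invertible for all $t\in\mathbb{R}$. Suppose that there exist $\omega>0$ and a constant matrix $C\in\mathcal{L}(\mathbb{R}^n)$ such that $A(t+\omega)-A(t)=C$ for all $t\in\mathbb{R}$. Let $U(t,s)$ be the transition matrix of the homogeneous generalized linear differential equation $$\frac{dx}{d\tau}=D[A(t)x].$$ Then this equation admits an exponential dichotomy on $\mathbb{R}$ if and only if no (complex) eigenvalue of the monodromy matrix $U(\omega,0)$ lies on the unit circle, i.e. every eigenvalue $\lambda\in\mathbb{C}$ of $U(\omega,0)$ satisfies $|\lambda|\neq 1$.
   Context: $\mathcal{L}(\mathbb{R}^n)$ is the space of real $n\times n$ matrices with the operator norm, and $I$ is the identity matrix. For a function $\Phi:[a,b]\to X$ into a Banach space, $\mathrm{var}_a^b(\Phi)$ is the supremum over partitions $a=\alpha_0<\alpha_1<\dots<\alpha_m=b$ of $\sum_{j=1}^m\|\Phi(\alpha_j)-\Phi(\alpha_{j-1})\|_X$. A function $\Phi:\mathbb{R}\to X$ is of locally bounded variation if $\mathrm{var}_a^b(\Phi)<\infty$ for every compact interval $[a,b]$; such a function has one-sided limits $\Phi(t^\pm)$ at every $t$, and $\Delta^{+}\Phi(t)=\Phi(t^+)-\Phi(t)$, $\Delta^{-}\Phi(t)=\Phi(t)-\Phi(t^-)$. Kurzweil--Stieltjes integral: $\int_a^b \mathrm{d}[A(s)]g(s)=\mathcal{X}$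 for $g:[a,b]\to\mathbb{R}^n$ means that for every $\varepsilon>0$ there is a function $\delta:[a,b]\to(0,\infty)$ such that $\big\|\sum_{j=1}^m[A(\alpha_j)-A(\alpha_{j-1})]g(\tau_j)-\mathcal{X}\big\|<\varepsilon$ for every partition $a=\alpha_0<\dots<\alpha_m=b$ with tags $\tau_j\in[\alpha_{j-1},\alpha_j]$ satisfying $[\alpha_{j-1},\alpha_j]\subset(\tau_j-\delta(\tau_j),\tau_j+\delta(\tau_j))$ for all $j$. Also $\int_b^a=-\int_a^b$ and $\int_c^c=0$. For matrix-valued integrands the integral is taken column by column. A solution on $\mathbb{R}$ of $\frac{dx}{d\tau}=D[A(t)x]$ is a function $x:\mathbb{R}\to\mathbb{R}^n$ such that $x(t)=x(s)+\int_s^t\mathrm{d}[A(r)]x(r)$ for all $s,t\in\mathbb{R}$ (the integrals existing). Under the stated hypotheses on $A$, there is a unique matrix function $U:\mathbb{R}\times\mathbb{R}\to\mathcal{L}(\mathbb{R}^n)$, the transition matrix, with $U(t,s)=I+\int_s^t\mathrm{d}[A(r)]U(r,s)$ for all $t,s\in\mathbb{R}$; each $U(t,s)$ is invertible. Set $\mathcal{U}(t)=U(t,0)$. The monodromy matrix is $\mathcal{U}(\omega)=U(\omega,0)$. The homogeneous equation admits an exponential dichotomy on $\mathbb{R}$ if there exist constants $K,\alpha>0$ and a projection (linear map with $P^2=P$) $P:\mathbb{R}^n\to\mathbb{R}^n$ such that $\|\mathcal{U}(t)P\mathcal{U}^{-1}(s)\|\le Ke^{-\alpha(t-s)}$ for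 all $t\ge s$, and $\|\mathcal{U}(t)(I-P)\mathcal{U}^{-1}(s)\|\le Ke^{-\alpha(s-t)}$ for all $s\ge t$, where $\mathcal{U}^{-1}(s)=[\mathcal{U}(s)]^{-1}$. *)

theory Defs
  imports "HOL-Analysis.Analysis"
begin

text \<open>
  The library norm on \<open>real^'n^'n\<close> is the Frobenius norm, so the operator norm (with respect to the
  Euclidean norm on \<open>real^'n\<close>) is introduced explicitly. The limits below use the product
  topology of \<open>real^'n^'n\<close>, which is the topology of the operator norm.
\<close>

definition op_norm :: "real^'n^'n \<Rightarrow> real" where
  "op_norm M = onorm (\<lambda>v. M *v v)"

text \<open>For \<open>a = b\<close> the only partition is the one with \<open>m = 0\<close>.\<close>

definition is_partition :: "real \<Rightarrow> real \<Rightarrow> nat \<Rightarrow> (nat \<Rightarrow> real) \<Rightarrow> bool" where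
  "is_partition a b m \<alpha> \<longleftrightarrow> \<alpha> 0 = a \<and> \<alpha> m = b \<and> (\<forall>j<m. \<alpha> j < \<alpha> (Suc j))"

definition variation :: "real \<Rightarrow> real \<Rightarrow> (real \<Rightarrow> real^'n^'n) \<Rightarrow> ereal" where
  "variation a b \<Phi> =
     (SUP (m, \<alpha>) \<in> {(m, \<alpha>). is_partition a b m \<alpha>}.
        ereal (\<Sum>j<m. op_norm (\<Phi> (\<alpha> (Suc j)) - \<Phi> (\<alpha> j))))"

definition locally_bounded_variation :: "(real \<Rightarrow> real^'n^'n) \<Rightarrow> bool" where
  "locally_bounded_variation \<Phi> \<longleftrightarrow> (\<forall>a b. a \<le> b \<longrightarrow> variation a b \<Phi> < \<infinity>)"

text \<open>
  The one-sided limits exist for functions of locally bounded variation; \<open>Lim\<close> is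
  unspecified otherwise.
\<close>

definition jump_right :: "(real \<Rightarrow> real^'n^'n) \<Rightarrow> real \<Rightarrow> real^'n^'n" where
  "jump_right \<Phi> t = Lim (at_right t) \<Phi> - \<Phi> t"

definition jump_left :: "(real \<Rightarrow> real^'n^'n) \<Rightarrow> real \<Rightarrow> real^'n^'n" where
  "jump_left \<Phi> t = \<Phi> t - Lim (at_left t) \<Phi>"

text \<open>The tag \<open>\<tau> j\<close> belongs to the subinterval from \<open>\<alpha> j\<close> to \<open>\<alpha> (Suc j)\<close>.\<close>

definition fine_tagged_partition ::
    "(real \<Rightarrow> real) \<Rightarrow> real \<Rightarrow> real \<Rightarrow> nat \<Rightarrow> (nat \<Rightarrow> real) \<Rightarrow> (nat \<Rightarrow> real) \<Rightarrow> bool" where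
  "fine_tagged_partition \<delta> a b m \<alpha> \<tau> \<longleftrightarrow>
     is_partition a b m \<alpha> \<and>
     (\<forall>j<m. \<tau> j \<in> {\<alpha> j..\<alpha> (Suc j)} \<and>
            {\<alpha> j..\<alpha> (Suc j)} \<subseteq> {\<tau> j - \<delta> (\<tau> j)<..<\<tau> j + \<delta> (\<tau> j)})"

text \<open>The Kurzweil--Stieltjes integral of a vector function, first for \<open>a < b\<close>.\<close>

definition has_KS_integral_fwd ::
    "(real \<Rightarrow> real^'n^'n) \<Rightarrow> (real \<Rightarrow> real^'n) \<Rightarrow> real \<Rightarrow> real \<Rightarrow> real^'n \<Rightarrow> bool" where
  "has_KS_integral_fwd A g a b X \<longleftrightarrow>
     (\<forall>\<epsilon>>0. \<exists>\<delta>. (\<forall>t\<in>{a..b}. 0 < \<delta> t) \<and>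
        (\<forall>m \<alpha> \<tau>. fine_tagged_partition \<delta> a b m \<alpha> \<tau> \<longrightarrow>
           norm ((\<Sum>j<m. (A (\<alpha> (Suc j)) - A (\<alpha> j)) *v g (\<tau> j)) - X) < \<epsilon>))"

definition has_KS_integral ::
    "(real \<Rightarrow> real^'n^'n) \<Rightarrow> (real \<Rightarrow> real^'n) \<Rightarrow> real \<Rightarrow> real \<Rightarrow> real^'n \<Rightarrow> bool" where
  "has_KS_integral A g s t X \<longleftrightarrow>
     (if s < t then has_KS_integral_fwd A g s t X
      else if s = t then X = 0
      else has_KS_integral_fwd A g t s (- X))"

definition has_KS_integral_matrix ::
    "(real \<Rightarrow> real^'n^'n) \<Rightarrow> (real \<Rightarrow> real^'n^'n) \<Rightarrow> real \<Rightarrow> real \<Rightarrow> real^'n^'n \<Rightarrow> bool" where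
  "has_KS_integral_matrix A G s t X \<longleftrightarrow>
     (\<forall>k. has_KS_integral A (\<lambda>r. column k (G r)) s t (column k X))"

definition is_transition_matrix ::
    "(real \<Rightarrow> real^'n^'n) \<Rightarrow> (real \<Rightarrow> real \<Rightarrow> real^'n^'n) \<Rightarrow> bool" where
  "is_transition_matrix A U \<longleftrightarrow>
     (\<forall>t s. \<exists>X. has_KS_integral_matrix A (\<lambda>r. U r s) s t X \<and> U t s = mat 1 + X)"

text \<open>
  Exponential dichotomy of \<open>dx/d\<tau> = D[A(t)x]\<close> on the whole line, with \<open>U t 0\<close> as the fundamental
  matrix. The transition matrix is unique for the coefficients \<open>A\<close> under consideration.
\<close>

definition admits_exponential_dichotomy :: "(real \<Rightarrow> real^'n^'n) \<Rightarrow> bool" where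
  "admits_exponential_dichotomy A \<longleftrightarrow>
     (\<exists>U. is_transition_matrix A U \<and>
       (\<exists>K \<alpha>. \<exists>P :: real^'n^'n. K > 0 \<and> \<alpha> > 0 \<and> P ** P = P \<and>
          (\<forall>t s. t \<ge> s \<longrightarrow>
             op_norm (U t 0 ** P ** matrix_inv (U s 0)) \<le> K * exp (- \<alpha> * (t - s))) \<and>
          (\<forall>t s. s \<ge> t \<longrightarrow>
             op_norm (U t 0 ** (mat 1 - P) ** matrix_inv (U s 0)) \<le> K * exp (- \<alpha> * (s - t)))))"

definition complex_eigenvalue :: "real^'n^'n \<Rightarrow> complex \<Rightarrow> bool" where
  "complex_eigenvalue M \<mu> \<longleftrightarrow>
     (\<exists>v :: complex^'n. v \<noteq> 0 \<and> map_matrix complex_of_real M *v v = \<mu> *s v)"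

end

theory Submission
  imports Defs "HOL-Computational_Algebra.Fundamental_Theorem_Algebra"
begin

text \<open>
  A solution has the one-sided limits \<open>x(t+) = (I + \<Delta>\<^sup>+A(t)) x(t)\<close> and \<open>x(t-) = (I - \<Delta>\<^sup>-A(t)) x(t)\<close>, and it
  stays zero near any of its zeros since the variation of \<open>A\<close> over \<open>(t, t + h]\<close> tends to \<open>0\<close>. By
  invertibility the zero set of a solution is therefore open and closed, which gives uniqueness, the
  invertibility of \<open>U(t, 0)\<close>, and with the periodicity of the increments of \<open>A\<close> the Floquet relation
  \<open>U(t + \<omega>, 0) = U(t, 0) M\<close> with \<open>M = U(\<omega>, 0)\<close>. Hence the dichotomy is a statement about the powers of \<open>M\<close>.
  If \<open>M v = \<mu> v\<close> with \<open>\<bar>\<mu>\<bar> = 1\<close>, the dichotomy at \<open>t = 0\<close>, \<open>s = \<plusminus>k\<omega>\<close> forces \<open>P v = 0 = (I - P) v\<close>. Conversely,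
  without unit eigenvalues \<open>P\<close> is the projection onto the generalized eigenspaces inside the unit disc.
\<close>

section \<open>Kurzweil--Stieltjes sums\<close>

text \<open>The variation of \<open>A\<close> over an interval [c, t] does not tend to 0 when
  \<open>A\<close> jumps at c, so no contraction estimate can start at c itself. Estimates run over
  [s, t] with c < s, and s then tends to c. Left-hand statements come from right-hand ones by the
  reflection t -> -t. The defining equation of \<open>U\<close> is anchored at one endpoint, while
  these estimates need every small interval nearby. Integrals over those are obtained by
  subtraction, with a fine partition of the discarded piece supplied by Cousin's lemma. The
  projection has to be real although the eigenvalues are complex. Each vector is killed by a product
  of factors T - \<lambda> over eigenvalues; the product is split into roots inside and outside the
  unit circle. Both regions are closed under conjugation, so taking real parts brings the splitting
  back to real vectors. Decay of powers follows from a recursion along the list of factors. Passing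
  from powers of \<open>M\<close> to all times uses that V(t) X V(s)^-1 does not change when both
  times move by \<omega>, for X commuting with \<open>M\<close>, and that V and its inverse are
  bounded over one period.\<close>

text \<open>Variation sums and Kurzweil--Stieltjes sums both run over consecutive intervals;
  \<open>R\<close> says what an interval may contribute. As a relation between endpoints and total,
  partitions can be concatenated, reflected and translated by rule induction, without
  indices.\<close>

inductive chain :: "(real \<Rightarrow> real \<Rightarrow> 'v \<Rightarrow> bool) \<Rightarrow> real \<Rightarrow> real \<Rightarrow> 'v::comm_monoid_add \<Rightarrow> bool"
  for R where
  nil: "chain R a a 0"
| snoc: "chain R a b X \<Longrightarrow> b < c \<Longrightarrow> R b c x \<Longrightarrow> chain R a c (X + x)"

lemma chain_le: "chain R a b X \<Longrightarrow> a \<le> b"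
  by (induction rule: chain.induct) auto

lemma chain_single: "a < b \<Longrightarrow> R a b x \<Longrightarrow> chain R a b x"
  using chain.snoc[OF chain.nil, of a b R x] by simp

lemma chain_trans: "chain R b c Y \<Longrightarrow> chain R a b X \<Longrightarrow> chain R a c (X + Y)"
proof (induction arbitrary: X rule: chain.induct)
  case (snoc a' b' Y' c' y)
  then show ?case using chain.snoc[of R a b' "X + Y'" c' y] by (simp add: add.assoc)
qed simp

lemma chain_mono:
  assumes "chain R a b X" "\<And>s t x. a \<le> s \<Longrightarrow> s < t \<Longrightarrow> t \<le> b \<Longrightarrow> R s t x \<Longrightarrow> R' s t x"
  shows "chain R' a b X"
  using assms
proof (induction rule: chain.induct)
  case (snoc a b X c x)
  then show ?case
    by (intro chain.snoc[of R' a b X c x]) (auto dest: chain_le)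
qed (rule chain.nil)

lemma chain_iff_partition:
  "chain R a b S \<longleftrightarrow>
     (\<exists>m \<alpha> y. is_partition a b m \<alpha> \<and> (\<forall>j<m. R (\<alpha> j) (\<alpha> (Suc j)) (y j)) \<and> S = (\<Sum>j<m. y j))"
proof
  assume "chain R a b S"
  then show "\<exists>m \<alpha> y. is_partition a b m \<alpha> \<and> (\<forall>j<m. R (\<alpha> j) (\<alpha> (Suc j)) (y j)) \<and> S = (\<Sum>j<m. y j)"
  proof (induction rule: chain.induct)
    case (nil a)
    show ?case by (rule exI[of _ 0], rule exI[of _ "\<lambda>_. a"]) (simp add: is_partition_def)
  next
    case (snoc a b X c x)
    then obtain m \<alpha> y where *: "is_partition a b m \<alpha>" "\<forall>j<m. R (\<alpha> j) (\<alpha> (Suc j)) (y j)"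
      "X = (\<Sum>j<m. y j)" by blast
    show ?case
      by (rule exI[of _ "Suc m"], rule exI[of _ "\<alpha>(Suc m := c)"], rule exI[of _ "y(m := x)"])
        (use * snoc in \<open>auto simp: is_partition_def less_Suc_eq\<close>)
  qed
next
  assume "\<exists>m \<alpha> y. is_partition a b m \<alpha> \<and> (\<forall>j<m. R (\<alpha> j) (\<alpha> (Suc j)) (y j)) \<and> S = (\<Sum>j<m. y j)"
  then obtain m \<alpha> y where *: "is_partition a b m \<alpha>" "\<forall>j<m. R (\<alpha> j) (\<alpha> (Suc j)) (y j)"
    "S = (\<Sum>j<m. y j)" by blast
  have "k \<le> m \<Longrightarrow> chain R (\<alpha> 0) (\<alpha> k) (\<Sum>j<k. y j)" for k
  proof (induction k)
    case (Suc k)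
    then show ?case
      using chain.snoc[of R "\<alpha> 0" "\<alpha> k" "\<Sum>j<k. y j" "\<alpha> (Suc k)" "y k"] *
      by (auto simp: is_partition_def)
  qed (auto intro: chain.nil)
  from this[of m] * show "chain R a b S" by (auto simp: is_partition_def)
qed

definition var_step :: "(real \<Rightarrow> real^'n^'n) \<Rightarrow> real \<Rightarrow> real \<Rightarrow> real \<Rightarrow> bool" where
  "var_step A b c x \<longleftrightarrow> x = op_norm (A c - A b)"

definition KS_step ::
    "(real \<Rightarrow> real^'n^'n) \<Rightarrow> (real \<Rightarrow> real^'n) \<Rightarrow> (real \<Rightarrow> real) \<Rightarrow> real \<Rightarrow> real \<Rightarrow> real^'n \<Rightarrow> bool" where
  "KS_step A g \<delta> b c x \<longleftrightarrow>
     (\<exists>\<tau>\<in>{b..c}. {b..c} \<subseteq> {\<tau> - \<delta> \<tau><..<\<tau> + \<delta> \<tau>} \<and> x = (A c - A b) *v g \<tau>)"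

lemma chain_KS_step_iff:
  "chain (KS_step A g \<delta>) a b S \<longleftrightarrow>
     (\<exists>m \<alpha> \<tau>. fine_tagged_partition \<delta> a b m \<alpha> \<tau> \<and>
        S = (\<Sum>j<m. (A (\<alpha> (Suc j)) - A (\<alpha> j)) *v g (\<tau> j)))"
proof
  assume "chain (KS_step A g \<delta>) a b S"
  then obtain m \<alpha> y where *: "is_partition a b m \<alpha>"
    "\<forall>j<m. KS_step A g \<delta> (\<alpha> j) (\<alpha> (Suc j)) (y j)" "S = (\<Sum>j<m. y j)"
    by (auto simp: chain_iff_partition)
  from *(2) obtain \<tau> where
    "\<forall>j<m. \<tau> j \<in> {\<alpha> j..\<alpha> (Suc j)} \<and> {\<alpha> j..\<alpha> (Suc j)} \<subseteq> {\<tau> j - \<delta> (\<tau> j)<..<\<tau> j + \<delta> (\<tau> j)} \<and>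
       y j = (A (\<alpha> (Suc j)) - A (\<alpha> j)) *v g (\<tau> j)"
    unfolding KS_step_def by metis
  with * show "\<exists>m \<alpha> \<tau>. fine_tagged_partition \<delta> a b m \<alpha> \<tau> \<and>
        S = (\<Sum>j<m. (A (\<alpha> (Suc j)) - A (\<alpha> j)) *v g (\<tau> j))"
    by (intro exI[of _ m] exI[of _ \<alpha>] exI[of _ \<tau>]) (auto simp: fine_tagged_partition_def)
next
  assume "\<exists>m \<alpha> \<tau>. fine_tagged_partition \<delta> a b m \<alpha> \<tau> \<and>
        S = (\<Sum>j<m. (A (\<alpha> (Suc j)) - A (\<alpha> j)) *v g (\<tau> j))"
  then obtain m \<alpha> \<tau> where "fine_tagged_partition \<delta> a b m \<alpha> \<tau>"
    "S = (\<Sum>j<m. (A (\<alpha> (Suc j)) - A (\<alpha> j)) *v g (\<tau> j))" by blast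
  then show "chain (KS_step A g \<delta>) a b S"
    unfolding chain_iff_partition fine_tagged_partition_def KS_step_def
    by (intro exI[of _ m] exI[of _ \<alpha>] exI[of _ "\<lambda>j. (A (\<alpha> (Suc j)) - A (\<alpha> j)) *v g (\<tau> j)"]) blast
qed

lemma KS_step_gauge_mono:
  assumes "KS_step A g \<delta> b c x" "\<And>t. t \<in> {b..c} \<Longrightarrow> \<delta> t \<le> \<delta>' t"
  shows "KS_step A g \<delta>' b c x"
proof -
  obtain \<tau> where \<tau>: "\<tau> \<in> {b..c}" "{b..c} \<subseteq> {\<tau> - \<delta> \<tau><..<\<tau> + \<delta> \<tau>}" "x = (A c - A b) *v g \<tau>"
    using assms(1) unfolding KS_step_def by blast
  have "{\<tau> - \<delta> \<tau><..<\<tau> + \<delta> \<tau>} \<subseteq> {\<tau> - \<delta>' \<tau><..<\<tau> + \<delta>' \<tau>}"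
    using assms(2)[OF \<tau>(1)] by auto
  with \<tau> show ?thesis unfolding KS_step_def by blast
qed

text \<open>A gauge on \<open>{a..b}\<close> can be set to 1 outside without changing which chains
  are fine. Positivity everywhere then survives restriction, reflection and translation with no side
  condition.\<close>

lemma has_KS_integral_fwd_iff:
  "has_KS_integral_fwd A g a b X \<longleftrightarrow>
     (\<forall>\<epsilon>>0. \<exists>\<delta>. (\<forall>t. 0 < \<delta> t) \<and> (\<forall>S. chain (KS_step A g \<delta>) a b S \<longrightarrow> norm (S - X) < \<epsilon>))"
    (is "?L \<longleftrightarrow> ?R")
proof -
  have *: "has_KS_integral_fwd A g a b X \<longleftrightarrow>
     (\<forall>\<epsilon>>0. \<exists>\<delta>. (\<forall>t\<in>{a..b}. 0 < \<delta> t) \<and> (\<forall>S. chain (KS_step A g \<delta>) a b S \<longrightarrow> norm (S - X) < \<epsilon>))"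
  proof -
    have "(\<forall>S. chain (KS_step A g \<delta>) a b S \<longrightarrow> norm (S - X) < \<epsilon>) \<longleftrightarrow>
       (\<forall>m \<alpha> \<tau>. fine_tagged_partition \<delta> a b m \<alpha> \<tau> \<longrightarrow>
           norm ((\<Sum>j<m. (A (\<alpha> (Suc j)) - A (\<alpha> j)) *v g (\<tau> j)) - X) < \<epsilon>)" for \<delta> \<epsilon>
      unfolding chain_KS_step_iff by auto
    then show ?thesis unfolding has_KS_integral_fwd_def by presburger
  qed
  show ?thesis
  proof
    assume ?L
    show ?R
    proof (intro allI impI)
      fix \<epsilon> :: real assume "\<epsilon> > 0"
      with \<open>?L\<close> obtain \<delta> where \<delta>: "\<forall>t\<in>{a..b}. 0 < \<delta> t"
        "\<forall>S. chain (KS_step A g \<delta>) a b S \<longrightarrow> norm (S - X) < \<epsilon>" unfolding * by blast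
      define \<delta>' where "\<delta>' t = (if t \<in> {a..b} then \<delta> t else 1)" for t
      have "chain (KS_step A g \<delta>) a b S" if "chain (KS_step A g \<delta>') a b S" for S
        using that by (rule chain_mono) (erule KS_step_gauge_mono, auto simp: \<delta>'_def)
      then show "\<exists>\<delta>. (\<forall>t. 0 < \<delta> t) \<and> (\<forall>S. chain (KS_step A g \<delta>) a b S \<longrightarrow> norm (S - X) < \<epsilon>)"
        using \<delta> by (intro exI[of _ \<delta>']) (auto simp: \<delta>'_def)
    qed
  next
    assume ?R
    show ?L unfolding *
    proof (intro allI impI)
      fix \<epsilon> :: real assume "\<epsilon> > 0"
      with \<open>?R\<close> show "\<exists>\<delta>. (\<forall>t\<in>{a..b}. 0 < \<delta> t) \<and>
        (\<forall>S. chain (KS_step A g \<delta>) a b S \<longrightarrow> norm (S - X) < \<epsilon>)" by blast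
    qed
  qed
qed

lemma has_KS_integral_fwdD:
  assumes "has_KS_integral_fwd A g a b X" "\<epsilon> > 0"
  obtains \<delta> where "\<And>t. 0 < \<delta> t" "\<And>S. chain (KS_step A g \<delta>) a b S \<Longrightarrow> norm (S - X) < \<epsilon>"
  using assms unfolding has_KS_integral_fwd_iff by blast

text \<open>Bisection: fine chains join at a common endpoint, and an interval around
  \<open>x\<close> shorter than \<open>\<delta> x\<close> is a single fine step with tag
  \<open>x\<close>.\<close>

lemma Cousin_fine_chain:
  assumes "a \<le> b" "\<And>t. 0 < \<delta> t"
  shows "\<exists>S. chain (KS_step A g \<delta>) a b S"
  using assms(1)
proof (induction rule: Bolzano)
  case (trans a b c)
  then show ?case using chain_trans by blast
next
  case (local x)
  show ?case
  proof (intro exI[of _ "\<delta> x"] conjI allI impI)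
    fix a b assume ab: "a \<le> x \<and> x \<le> b \<and> b - a < \<delta> x"
    show "\<exists>S. chain (KS_step A g \<delta>) a b S"
    proof (cases "a = b")
      case True then show ?thesis using chain.nil by blast
    next
      case False
      with ab have "KS_step A g \<delta> a b ((A b - A a) *v g x)"
        unfolding KS_step_def by (intro bexI[of _ x]) auto
      with False ab show ?thesis using chain_single[of a b] by (metis less_le order_trans)
    qed
  qed (use assms in auto)
qed

text \<open>Fineness for the pointwise minimum implies fineness for both gauges, so one and the same
  sum can be compared with two integrals.\<close>

lemma Cousin_fine_chain2:
  assumes "a \<le> b" "\<And>t. 0 < \<delta> t" "\<And>t. 0 < \<delta>' t"
  obtains S where "chain (KS_step A g \<delta>) a b S" "chain (KS_step A g \<delta>') a b S"
proof -
  obtain S where S: "chain (KS_step A g (\<lambda>t. min (\<delta> t) (\<delta>' t))) a b S"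
    using Cousin_fine_chain[OF assms(1), of "\<lambda>t. min (\<delta> t) (\<delta>' t)" A g] assms by auto
  show ?thesis
    by (rule that[of S]; rule chain_mono[OF S]; erule KS_step_gauge_mono) auto
qed

text \<open>Integrability over [b, c] is a conclusion here. One chain \<open>T\<close> on [a, b],
  fine for both gauges, is put in front of every chain on [b, c]: \<open>T + S\<close> is near
  \<open>X\<close> and \<open>T\<close> is near \<open>Y\<close>, so \<open>S\<close> is near
  \<open>X - Y\<close>.\<close>

lemma has_KS_integral_fwd_diff_left:
  assumes ac: "has_KS_integral_fwd A g a c X" and ab: "has_KS_integral_fwd A g a b Y"
    and "a \<le> b"
  shows "has_KS_integral_fwd A g b c (X - Y)"
  unfolding has_KS_integral_fwd_iff
proof (intro allI impI)
  fix \<epsilon> :: real assume "\<epsilon> > 0"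
  then have e: "\<epsilon> / 2 > 0" by simp
  obtain \<delta> where \<delta>: "\<And>t. 0 < \<delta> t" "\<And>S. chain (KS_step A g \<delta>) a c S \<Longrightarrow> norm (S - X) < \<epsilon> / 2"
    using has_KS_integral_fwdD[OF ac e] by blast
  obtain \<delta>' where \<delta>': "\<And>t. 0 < \<delta>' t" "\<And>S. chain (KS_step A g \<delta>') a b S \<Longrightarrow> norm (S - Y) < \<epsilon> / 2"
    using has_KS_integral_fwdD[OF ab e] by blast
  obtain T where T: "chain (KS_step A g \<delta>) a b T" "chain (KS_step A g \<delta>') a b T"
    by (rule Cousin_fine_chain2[where A = A and g = g, OF \<open>a \<le> b\<close> \<delta>(1) \<delta>'(1)])
  have "norm (S - (X - Y)) < \<epsilon>" if "chain (KS_step A g \<delta>) b c S" for S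
  proof -
    have "norm (T + S - X) < \<epsilon> / 2" using \<delta>(2) chain_trans[OF that T(1)] by blast
    moreover have "norm (T - Y) < \<epsilon> / 2" using \<delta>'(2) T(2) by blast
    moreover have "norm (S - (X - Y)) \<le> norm (T + S - X) + norm (T - Y)"
      using norm_triangle_ineq4[of "T + S - X" "T - Y"] by (simp add: algebra_simps)
    ultimately show ?thesis by linarith
  qed
  with \<delta>(1) show "\<exists>\<delta>. (\<forall>t. 0 < \<delta> t) \<and>
      (\<forall>S. chain (KS_step A g \<delta>) b c S \<longrightarrow> norm (S - (X - Y)) < \<epsilon>)" by blast
qed

lemma chain_reflect:
  assumes "chain R a b X" "\<And>s t x. R s t x \<Longrightarrow> R' (-t) (-s) (f x)" "f 0 = 0" "\<And>x y. f (x + y) = f y + f x"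
  shows "chain R' (-b) (-a) (f X)"
  using assms
proof (induction rule: chain.induct)
  case (snoc a b X c x)
  then show ?case
    using chain_trans[of R' "-b" "-a" "f X" "-c" "f x"] chain_single[of "-c" "-b" R' "f x"] by auto
qed (auto intro: chain.nil)

lemma KS_step_reflect:
  assumes "KS_step A g \<delta> s t x"
  shows "KS_step (\<lambda>t. A (-t)) (\<lambda>t. g (-t)) (\<lambda>t. \<delta> (-t)) (-t) (-s) (-x)"
proof -
  obtain \<tau> where \<tau>: "\<tau> \<in> {s..t}" "{s..t} \<subseteq> {\<tau> - \<delta> \<tau><..<\<tau> + \<delta> \<tau>}" "x = (A t - A s) *v g \<tau>"
    using assms unfolding KS_step_def by blast
  have 1: "- x = (A s - A t) *v g \<tau>"
    unfolding \<tau>(3) by (simp add: matrix_vector_mult_diff_rdistrib)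
  have "s \<in> {s..t}" "t \<in> {s..t}" using \<tau>(1) by auto
  then have "\<tau> - \<delta> \<tau> < s" "t < \<tau> + \<delta> \<tau>" using \<tau>(2) by fastforce+
  then have "{-t..-s} \<subseteq> {-\<tau> - \<delta> \<tau><..<-\<tau> + \<delta> \<tau>}" by auto
  with \<tau>(1) 1 show ?thesis unfolding KS_step_def by (intro bexI[of _ "-\<tau>"]) auto
qed

text \<open>Reversing time reverses each increment of \<open>A\<close>, hence the sign. With
  \<open>X\<close> an increment of the solution, the integral equation keeps its form, which is what
  lets left-sided facts be read off from right-sided ones.\<close>

lemma has_KS_integral_fwd_reflect:
  assumes "has_KS_integral_fwd A g a b X"
  shows "has_KS_integral_fwd (\<lambda>t. A (-t)) (\<lambda>t. g (-t)) (-b) (-a) (-X)"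
  unfolding has_KS_integral_fwd_iff
proof (intro allI impI)
  fix \<epsilon> :: real assume "\<epsilon> > 0"
  obtain \<delta> where \<delta>: "\<And>t. 0 < \<delta> t" "\<And>S. chain (KS_step A g \<delta>) a b S \<Longrightarrow> norm (S - X) < \<epsilon>"
    using has_KS_integral_fwdD[OF assms \<open>\<epsilon> > 0\<close>] by blast
  have *: "norm (S - (-X)) < \<epsilon>"
    if "chain (KS_step (\<lambda>t. A (-t)) (\<lambda>t. g (-t)) (\<lambda>t. \<delta> (-t))) (-b) (-a) S" for S
  proof -
    have "chain (KS_step A g \<delta>) (-(-a)) (-(-b)) (-S)"
      using that
    proof (rule chain_reflect[where f = uminus])
      show "KS_step A g \<delta> (-t) (-s) (-x)"
        if "KS_step (\<lambda>t. A (-t)) (\<lambda>t. g (-t)) (\<lambda>t. \<delta> (-t)) s t x" for s t x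
        using KS_step_reflect[OF that] by simp
    qed auto
    then have "norm (- S - X) < \<epsilon>" using \<delta>(2) by simp
    moreover have "S - (- X) = - (- S - X)" by simp
    ultimately show ?thesis by (metis norm_minus_cancel)
  qed
  show "\<exists>\<delta>. (\<forall>t. 0 < \<delta> t) \<and>
      (\<forall>S. chain (KS_step (\<lambda>t. A (-t)) (\<lambda>t. g (-t)) \<delta>) (-b) (-a) S \<longrightarrow> norm (S - (-X)) < \<epsilon>)"
  proof (rule exI[of _ "\<lambda>t. \<delta> (-t)"], intro conjI allI)
    show "0 < \<delta> (-t)" for t by (rule \<delta>(1))
    show "chain (KS_step (\<lambda>t. A (-t)) (\<lambda>t. g (-t)) (\<lambda>t. \<delta> (-t))) (-b) (-a) S \<longrightarrow> norm (S - (-X)) < \<epsilon>" for S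
      using * by (rule impI)
  qed
qed

lemma has_KS_integral_fwd_diff_right:
  assumes "has_KS_integral_fwd A g a c X" "has_KS_integral_fwd A g b c Y" "b \<le> c"
  shows "has_KS_integral_fwd A g a b (X - Y)"
proof -
  have "- c \<le> - b" using assms(3) by simp
  note has_KS_integral_fwd_diff_left[OF has_KS_integral_fwd_reflect[OF assms(1)]
      has_KS_integral_fwd_reflect[OF assms(2)] this]
  note has_KS_integral_fwd_reflect[OF this]
  then show ?thesis unfolding minus_minus minus_diff_minus by simp
qed

section \<open>One-sided behaviour of solutions\<close>

lemma norm_matrix_vector_le: "norm (M *v x) \<le> op_norm M * norm x"
  unfolding op_norm_def by (rule onorm[OF matrix_vector_mul_bounded_linear])

lemma op_norm_nonneg: "0 \<le> op_norm M"
  unfolding op_norm_def by (rule onorm_pos_le[OF matrix_vector_mul_bounded_linear])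

lemma op_norm_mult: "op_norm (M ** N) \<le> op_norm M * op_norm N"
  using onorm_compose[OF matrix_vector_mul_bounded_linear matrix_vector_mul_bounded_linear, of M N]
  by (simp add: op_norm_def o_def matrix_vector_mul_assoc)

lemma op_norm_add: "op_norm (M + N) \<le> op_norm M + op_norm N"
  using onorm_triangle[OF matrix_vector_mul_bounded_linear matrix_vector_mul_bounded_linear, of M N]
  by (simp add: op_norm_def matrix_vector_mult_add_rdistrib)

lemma op_norm_minus [simp]: "op_norm (- M) = op_norm M"
proof -
  have "(\<lambda>v. (- M) *v v) = (\<lambda>v. - (M *v v))"
    using matrix_vector_mult_diff_rdistrib[of 0 M] by auto
  then show ?thesis unfolding op_norm_def by (simp add: onorm_neg)
qed

lemma op_norm_minus_commute: "op_norm (M - N) = op_norm (N - M)"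
  by (metis op_norm_minus minus_diff_eq)

lemma abs_entry_le_op_norm: "\<bar>M $ i $ j\<bar> \<le> op_norm M"
  unfolding op_norm_def by (rule matrix_component_le_onorm)

lemma op_norm_le_entries: "(\<And>i j. \<bar>(M::real^'n^'n) $ i $ j\<bar> \<le> B) \<Longrightarrow> op_norm M \<le> real CARD('n) * real CARD('n) * B"
  unfolding op_norm_def by (rule onorm_le_matrix_component)

text \<open>The operator norm bounds the entries, and these bound the Frobenius norm. The crude
  constant is harmless, as it only serves to transfer limits between the two norms.\<close>

lemma norm_le_op_norm: "norm (M :: real^'n^'n) \<le> real CARD('n) * real CARD('n) * op_norm M"
proof -
  have "norm (M $ i) \<le> real CARD('n) * op_norm M" for i
    by (rule order_trans[OF norm_le_l1_cart])
      (rule order_trans[OF sum_bounded_above[where K = "op_norm M"]], auto intro: abs_entry_le_op_norm)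
  then have "(\<Sum>i\<in>UNIV. norm (M $ i)) \<le> real CARD('n) * (real CARD('n) * op_norm M)"
    using sum_bounded_above[of UNIV "\<lambda>i. norm (M $ i)" "real CARD('n) * op_norm M"] by simp
  moreover have "norm M \<le> (\<Sum>i\<in>UNIV. norm (M $ i))"
    unfolding norm_vec_def[of M] by (rule L2_set_le_sum) simp
  ultimately show ?thesis by (simp add: mult.assoc)
qed

lemma op_norm_le_norm: "op_norm (M :: real^'n^'n) \<le> real CARD('n) * real CARD('n) * norm M"
proof (rule op_norm_le_entries)
  show "\<bar>M $ i $ j\<bar> \<le> norm M" for i j
    using component_le_norm_cart[of "M $ i" j] Finite_Cartesian_Product.norm_nth_le[of M i] by linarith
qed

lemma op_norm_tendsto_zero:
  fixes M :: "'a \<Rightarrow> real^'n^'n"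
  assumes "(M \<longlongrightarrow> L) F"
  shows "((\<lambda>t. op_norm (M t - L)) \<longlongrightarrow> 0) F"
proof (rule tendsto_sandwich[of "\<lambda>_. 0"])
  have "((\<lambda>t. norm (M t - L)) \<longlongrightarrow> 0) F"
    using assms tendsto_norm_zero LIM_zero by blast
  then show "((\<lambda>t. real CARD('n) * real CARD('n) * norm (M t - L)) \<longlongrightarrow> 0) F"
    using tendsto_mult_right_zero by blast
qed (auto simp: op_norm_nonneg op_norm_le_norm)

lemma tendsto_matrix_vector [tendsto_intros]:
  fixes M :: "'a \<Rightarrow> real^'n^'n"
  assumes "(M \<longlongrightarrow> L) F"
  shows "((\<lambda>t. M t *v x) \<longlongrightarrow> L *v x) F"
proof -
  have "((\<lambda>t. op_norm (M t - L) * norm x) \<longlongrightarrow> 0) F"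
    using op_norm_tendsto_zero[OF assms] tendsto_mult_left_zero by blast
  then have "((\<lambda>t. (M t - L) *v x) \<longlongrightarrow> 0) F"
    by (rule Lim_null_comparison[rotated]) (auto simp: norm_matrix_vector_le)
  then show ?thesis by (simp add: LIM_zero_cancel matrix_vector_mult_diff_rdistrib)
qed

lemma matrix_add_rdistrib: "((A :: 'a::semiring_1^'n^'m) + B) ** C = A ** C + B ** C"
  by (simp add: vec_eq_iff matrix_matrix_mult_def distrib_right sum.distrib)

lemma matrix_inv_works:
  assumes "invertible (M :: real^'n^'n)"
  shows "M ** matrix_inv M = mat 1" "matrix_inv M ** M = mat 1"
  using assms someI_ex[of "\<lambda>N. M ** N = mat 1 \<and> N ** M = mat 1"]
  unfolding invertible_def matrix_inv_def by auto

lemma matrix_inv_eqI: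
  assumes "N ** M = mat 1"
  shows "matrix_inv M = (N :: real^'n^'n)"
proof -
  have "invertible M" using assms invertible_left_inverse by blast
  then have "N ** (M ** matrix_inv M) = N" by (simp add: matrix_inv_works)
  with assms show ?thesis by (simp add: matrix_mul_assoc)
qed

lemma invertible_mult_vec_eq_0:
  assumes "invertible (M :: real^'n^'n)" "M *v x = 0"
  shows "x = 0"
proof -
  have "matrix_inv M *v (M *v x) = x"
    by (simp add: matrix_vector_mul_assoc matrix_inv_works assms(1))
  with assms(2) show ?thesis by simp
qed

text \<open>From \<open>M\<inverse> = L\<inverse> - M\<inverse> (M - L) L\<inverse>\<close>.\<close>

lemma op_norm_matrix_inv_le:
  fixes M L :: "real^'n^'n"
  assumes "invertible M" "invertible L" "op_norm (M - L) * op_norm (matrix_inv L) \<le> 1 / 2"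
  shows "op_norm (matrix_inv M) \<le> 2 * op_norm (matrix_inv L)"
proof -
  let ?M = "matrix_inv M" and ?L = "matrix_inv L"
  have "?M = ?L - ?M ** (M - L) ** ?L"
  proof -
    have "?M ** M ** ?L = ?M ** (M - L) ** ?L + ?M ** (L ** ?L)"
      using matrix_add_ldistrib[of ?M "M - L" L] matrix_add_rdistrib[of "?M ** (M - L)" "?M ** L" ?L]
      by (simp add: matrix_mul_assoc)
    then have "?L = ?M ** (M - L) ** ?L + ?M" by (simp add: matrix_inv_works assms)
    then show ?thesis by (metis add_diff_cancel_left')
  qed
  then have "op_norm ?M \<le> op_norm ?L + op_norm (?M ** ((M - L) ** ?L))"
    using op_norm_add[of ?L "- (?M ** (M - L) ** ?L)"] by (simp add: matrix_mul_assoc)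
  also have "op_norm (?M ** ((M - L) ** ?L)) \<le> op_norm ?M * (op_norm (M - L) * op_norm ?L)"
    by (rule order_trans[OF op_norm_mult]) (intro mult_left_mono op_norm_mult op_norm_nonneg)
  also have "\<dots> \<le> op_norm ?M * (1 / 2)"
    by (intro mult_left_mono assms op_norm_nonneg)
  finally show ?thesis by simp
qed

section \<open>Bounded variation and one-sided limits of the coefficient\<close>

text \<open>A real bound over all chains replaces the \<open>ereal\<close> supremum; the condition
  \<open>a \<le> b\<close> is already contained in \<open>chain\<close>.\<close>

definition bounded_var :: "(real \<Rightarrow> real^'n^'n) \<Rightarrow> bool" where
  "bounded_var A \<longleftrightarrow> (\<forall>a b. \<exists>B. \<forall>W. chain (var_step A) a b W \<longrightarrow> W \<le> B)"

lemma locally_bounded_variation_imp_bounded_var: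
  assumes "locally_bounded_variation A"
  shows "bounded_var A"
  unfolding bounded_var_def
proof (intro allI)
  fix a b :: real
  show "\<exists>B. \<forall>W. chain (var_step A) a b W \<longrightarrow> W \<le> B"
  proof (intro exI[of _ "real_of_ereal (variation a b A)"] allI impI)
    fix W assume W: "chain (var_step A) a b W"
    then have "a \<le> b" by (rule chain_le)
    then have fin: "variation a b A < \<infinity>" using assms by (auto simp: locally_bounded_variation_def)
    from W obtain m \<alpha> y where "is_partition a b m \<alpha>"
      "\<forall>j<m. y j = op_norm (A (\<alpha> (Suc j)) - A (\<alpha> j))" "W = (\<Sum>j<m. y j)"
      unfolding chain_iff_partition var_step_def by blast
    then have "ereal W \<le> variation a b A"
      unfolding variation_def by (intro SUP_upper2[of "(m, \<alpha>)"]) auto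
    with fin show "W \<le> real_of_ereal (variation a b A)"
      by (cases "variation a b A") auto
  qed
qed

lemma bounded_var_reflect:
  assumes "bounded_var A"
  shows "bounded_var (\<lambda>t. A (- t))"
  unfolding bounded_var_def
proof (intro allI)
  fix a b
  obtain B where B: "\<And>W. chain (var_step A) (-b) (-a) W \<Longrightarrow> W \<le> B"
    using assms unfolding bounded_var_def by blast
  have "chain (var_step A) (-b) (-a) W" if "chain (var_step (\<lambda>t. A (- t))) a b W" for W
    using that
    by (rule chain_reflect[where f = "\<lambda>x. x"]) (auto simp: var_step_def op_norm_minus_commute)
  then show "\<exists>B. \<forall>W. chain (var_step (\<lambda>t. A (- t))) a b W \<longrightarrow> W \<le> B" using B by blast
qed

lemma var_chain_exists:
  assumes "a \<le> b"
  shows "\<exists>W. chain (var_step A) a b W \<and> op_norm (A b - A a) \<le> W"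
proof (cases "a = b")
  case True
  then show ?thesis by (intro exI[of _ 0]) (auto simp: chain.nil op_norm_def onorm_zero)
next
  case False
  with assms show ?thesis
    by (intro exI[of _ "op_norm (A b - A a)"]) (auto intro!: chain_single simp: var_step_def)
qed

text \<open>The variation over \<open>[c, t]\<close> is monotone in \<open>t\<close>, hence Cauchy as \<open>t\<close> tends to \<open>c\<close> from the right.\<close>

lemma small_variation_right:
  assumes "bounded_var A" "\<epsilon> > 0"
  obtains d where "d > c" "\<And>s t W. c < s \<Longrightarrow> t \<le> d \<Longrightarrow> chain (var_step A) s t W \<Longrightarrow> W \<le> \<epsilon>"
proof -
  define V where "V t = Sup {W. chain (var_step A) c t W}" for t
  have bdd: "bdd_above {W. chain (var_step A) c t W}" for t
    using assms(1) unfolding bounded_var_def bdd_above_def by blast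
  have up: "V s + W \<le> V t" if "chain (var_step A) s t W" "c \<le> s" for s t W
  proof -
    have "V s \<le> V t - W" unfolding V_def[of s]
    proof (rule cSup_least)
      show "{W. chain (var_step A) c s W} \<noteq> {}" using var_chain_exists[OF that(2)] by blast
      fix X assume "X \<in> {W. chain (var_step A) c s W}"
      then have "X + W \<le> V t" unfolding V_def using chain_trans[OF that(1)] bdd
        by (intro cSup_upper) auto
      then show "X \<le> V t - W" by simp
    qed
    then show ?thesis by simp
  qed
  have nonneg: "0 \<le> V t" if "c \<le> t" for t
  proof -
    obtain W where "chain (var_step A) c t W" "op_norm (A t - A c) \<le> W"
      using var_chain_exists[OF \<open>c \<le> t\<close>] by blast
    then have "0 \<le> W" "W \<le> V t"
      unfolding V_def using op_norm_nonneg[of "A t - A c"] bdd by (auto intro: cSup_upper)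
    then show ?thesis by simp
  qed
  \<comment> \<open>\<open>L\<close> is the limit of \<open>V\<close> at \<open>c\<close> from the
    right. It is positive if \<open>A\<close> jumps there to the right, so small variation can only
    be had on intervals starting strictly after \<open>c\<close>.\<close>
  define L where "L = Inf (V ` {c<..})"
  have bb: "bdd_below (V ` {c<..})" using nonneg by (intro bdd_belowI[of _ 0]) auto
  obtain d where d: "d > c" "V d < L + \<epsilon>"
  proof -
    have "L < L + \<epsilon>" using assms by simp
    then show ?thesis
      unfolding L_def using bb that cInf_less_iff[of "V ` {c<..}" "Inf (V ` {c<..}) + \<epsilon>"]
      by (auto simp: L_def)
  qed
  have "W \<le> \<epsilon>" if "c < s" "t \<le> d" "chain (var_step A) s t W" for s t W
  proof -
    have "L \<le> V s" unfolding L_def using bb that by (intro cInf_lower) auto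
    moreover have "V s + W \<le> V t" using up that by simp
    moreover have "V t \<le> V d"
    proof -
      obtain W' where "chain (var_step A) t d W'" "op_norm (A d - A t) \<le> W'"
        using var_chain_exists[OF \<open>t \<le> d\<close>] by blast
      then show ?thesis using up[of t d W'] chain_le[OF that(3)] that op_norm_nonneg[of "A d - A t"] by auto
    qed
    ultimately show ?thesis using d by linarith
  qed
  with d show ?thesis using that by blast
qed

text \<open>Small variation on (c, d] makes \<open>A\<close> Cauchy from the right, and completeness
  supplies the limit that \<open>Lim\<close> in \<open>jump_right\<close> refers to.\<close>

lemma bounded_var_tendsto_right:
  fixes A :: "real \<Rightarrow> real^'n^'n"
  assumes "bounded_var A"
  shows "(A \<longlongrightarrow> A c + jump_right A c) (at_right c)"
proof -
  have "cauchy_filter (filtermap A (at_right c))"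
    unfolding cauchy_filter_metric_filtermap
  proof (intro allI impI)
    fix e :: real assume "e > 0"
    define k where "k = real CARD('n) * real CARD('n)"
    have k: "k > 0" by (simp add: k_def)
    obtain d where d: "d > c" "\<And>s t W. c < s \<Longrightarrow> t \<le> d \<Longrightarrow> chain (var_step A) s t W \<Longrightarrow> W \<le> e / (2 * k)"
      using small_variation_right[OF assms, of "e / (2 * k)" c] k \<open>e > 0\<close> by auto
    have *: "dist (A s) (A t) < e" if "c < s" "s \<le> t" "t \<le> d" for s t
    proof -
      obtain W where "chain (var_step A) s t W" "op_norm (A t - A s) \<le> W"
        using var_chain_exists[OF \<open>s \<le> t\<close>] by blast
      with d(2) that have "op_norm (A t - A s) \<le> e / (2 * k)" by force
      then have "k * op_norm (A t - A s) \<le> e / 2" using k by (simp add: field_simps)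
      then have "norm (A t - A s) \<le> e / 2" using norm_le_op_norm[of "A t - A s"] unfolding k_def by linarith
      with \<open>e > 0\<close> show ?thesis by (simp add: dist_norm norm_minus_commute)
    qed
    show "\<exists>P. eventually P (at_right c) \<and> (\<forall>x y. P x \<and> P y \<longrightarrow> dist (A x) (A y) < e)"
    proof (intro exI[of _ "\<lambda>t. c < t \<and> t \<le> d"] conjI allI impI)
      show "\<forall>\<^sub>F t in at_right c. c < t \<and> t \<le> d"
        unfolding eventually_at_right_field using d(1) by (intro exI[of _ d]) auto
      fix x y assume "(c < x \<and> x \<le> d) \<and> c < y \<and> y \<le> d"
      then show "dist (A x) (A y) < e" using *[of x y] *[of y x] by (cases "x \<le> y") (auto simp: dist_commute)
    qed
  qed
  then obtain L where "filtermap A (at_right c) \<le> nhds L"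
    using cauchy_filter_complete_converges[OF _ complete_UNIV, of "filtermap A (at_right c)"]
    by (auto simp: filtermap_bot_iff)
  then have L: "(A \<longlongrightarrow> L) (at_right c)" by (simp add: filterlim_def)
  then have "Lim (at_right c) A = L" by (intro tendsto_Lim) auto
  with L show ?thesis by (simp add: jump_right_def)
qed

text \<open>Thus \<open>mat 1 - jump_left A c\<close> is \<open>mat 1 + jump_right\<close> of the
  reflected coefficient at \<open>- c\<close>: the hypothesis on left jumps is the one on right
  jumps in reversed time.\<close>

lemma jump_right_reflect:
  assumes "bounded_var A"
  shows "jump_right (\<lambda>t. A (- t)) (- c) = - jump_left A c"
proof -
  let ?L = "Lim (at_right (- c)) (\<lambda>t. A (- t))"
  have "((\<lambda>t. A (- t)) \<longlongrightarrow> ?L) (at_right (- c))"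
    using bounded_var_tendsto_right[OF bounded_var_reflect[OF assms], of "- c"] by (simp add: jump_right_def)
  then have "(A \<longlongrightarrow> ?L) (at_left c)"
    unfolding at_left_minus[of c] filterlim_filtermap by simp
  then have "Lim (at_left c) A = ?L" by (intro tendsto_Lim) auto
  then show ?thesis by (simp add: jump_right_def jump_left_def)
qed

section \<open>Solutions just to the right of a point\<close>

text \<open>All subintervals [s, t] are included because the estimates start at s > c, past a
  possible jump at \<open>c\<close>.\<close>

definition right_sol :: "(real \<Rightarrow> real^'n^'n) \<Rightarrow> (real \<Rightarrow> real^'n) \<Rightarrow> real \<Rightarrow> bool" where
  "right_sol A x c \<longleftrightarrow>
     (\<exists>d>c. \<forall>s t. c \<le> s \<longrightarrow> s < t \<longrightarrow> t \<le> d \<longrightarrow> has_KS_integral_fwd A x s t (x t - x s))"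

text \<open>The Saks--Henstock lemma for the single tagged interval \<open>[c, t]\<close>.\<close>

lemma right_sol_increment:
  assumes "right_sol A x c"
  shows "((\<lambda>t. (A t - A c) *v x c - (x t - x c)) \<longlongrightarrow> 0) (at_right c)"
proof (rule tendstoI)
  fix e :: real assume "e > 0"
  then have e: "e / 2 > 0" by simp
  obtain d where d: "d > c" "\<And>s t. c \<le> s \<Longrightarrow> s < t \<Longrightarrow> t \<le> d \<Longrightarrow> has_KS_integral_fwd A x s t (x t - x s)"
    using assms unfolding right_sol_def by blast
  have cd: "has_KS_integral_fwd A x c d (x d - x c)" using d by simp
  obtain \<delta> where \<delta>: "\<And>t. 0 < \<delta> t" "\<And>S. chain (KS_step A x \<delta>) c d S \<Longrightarrow> norm (S - (x d - x c)) < e / 2"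
    using has_KS_integral_fwdD[OF cd e] by blast
  have "\<forall>\<^sub>F t in at_right c. c < t \<and> t < min d (c + \<delta> c)"
    unfolding eventually_at_right_field using d(1) \<delta>(1)[of c]
    by (intro exI[of _ "min d (c + \<delta> c)"]) auto
  then show "\<forall>\<^sub>F t in at_right c. dist ((A t - A c) *v x c - (x t - x c)) 0 < e"
  proof (rule eventually_mono)
    fix t assume t: "c < t \<and> t < min d (c + \<delta> c)"
    then have td: "has_KS_integral_fwd A x t d (x d - x t)" using d by simp
    obtain \<delta>' where \<delta>': "\<And>t. 0 < \<delta>' t" "\<And>S. chain (KS_step A x \<delta>') t d S \<Longrightarrow> norm (S - (x d - x t)) < e / 2"
      using has_KS_integral_fwdD[OF td e] by blast
    have "t \<le> d" using t by simp
    obtain T where T: "chain (KS_step A x \<delta>) t d T" "chain (KS_step A x \<delta>') t d T"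
      by (rule Cousin_fine_chain2[where A = A and g = x, OF \<open>t \<le> d\<close> \<delta>(1) \<delta>'(1)])
    \<comment> \<open>Since t < c + \<delta> c, the interval [c, t] with tag \<open>c\<close> is one
      fine step. \<open>T\<close> completes it to a chain on [c, d] and cancels against the integral
      over [t, d].\<close>
    have "KS_step A x \<delta> c t ((A t - A c) *v x c)"
      unfolding KS_step_def using t \<delta>(1)[of c] by (intro bexI[of _ c]) auto
    then have "chain (KS_step A x \<delta>) c d ((A t - A c) *v x c + T)"
      using t T(1) by (intro chain_trans[of _ t]) (auto intro: chain_single)
    then have 1: "norm ((A t - A c) *v x c + T - (x d - x c)) < e / 2" by (rule \<delta>(2))
    have 2: "norm (T - (x d - x t)) < e / 2" using T(2) by (rule \<delta>'(2))
    have "norm (((A t - A c) *v x c + T - (x d - x c)) - (T - (x d - x t))) < e"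
      using norm_triangle_ineq4[of "(A t - A c) *v x c + T - (x d - x c)" "T - (x d - x t)"] 1 2 by linarith
    then show "dist ((A t - A c) *v x c - (x t - x c)) 0 < e" by (simp add: algebra_simps)
  qed
qed

lemma right_sol_tendsto:
  assumes "bounded_var A" "right_sol A x c"
  shows "(x \<longlongrightarrow> (mat 1 + jump_right A c) *v x c) (at_right c)"
proof -
  have "((\<lambda>t. (A t - A c) *v x c + x c - ((A t - A c) *v x c - (x t - x c))) \<longlongrightarrow>
      (A c + jump_right A c - A c) *v x c + x c - 0) (at_right c)"
    by (intro tendsto_intros bounded_var_tendsto_right right_sol_increment assms)
  then show ?thesis by (simp add: matrix_vector_mult_add_rdistrib add.commute)
qed

lemma norm_KS_chain_le:
  assumes "chain (KS_step A x \<delta>) s t S" "\<And>\<tau>. \<tau> \<in> {s..t} \<Longrightarrow> norm (x \<tau>) \<le> B"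
  shows "\<exists>W. chain (var_step A) s t W \<and> norm S \<le> B * W"
  using assms
proof (induction rule: chain.induct)
  case (nil a)
  show ?case by (rule exI[of _ 0]) (auto intro: chain.nil)
next
  case (snoc a b X c y)
  have "a \<le> b" using snoc by (auto dest: chain_le)
  obtain W where W: "chain (var_step A) a b W" "norm X \<le> B * W" using snoc by force
  obtain \<tau> where \<tau>: "\<tau> \<in> {b..c}" "y = (A c - A b) *v x \<tau>" using snoc unfolding KS_step_def by blast
  have "norm y \<le> op_norm (A c - A b) * B"
    unfolding \<tau>(2)
    by (rule order_trans[OF norm_matrix_vector_le])
      (use snoc.prems[of \<tau>] \<tau>(1) \<open>a \<le> b\<close> op_norm_nonneg in \<open>auto intro!: mult_left_mono\<close>)
  then have "norm (X + y) \<le> B * (W + op_norm (A c - A b))"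
    using W norm_triangle_ineq[of X y] by (simp add: algebra_simps)
  then show ?case
    using chain.snoc[OF W(1) \<open>b < c\<close>, of "op_norm (A c - A b)"] var_step_def by blast
qed

lemma norm_KS_integral_le:
  assumes int: "has_KS_integral_fwd A x s t X" and "s \<le> t"
    and B: "\<And>\<tau>. \<tau> \<in> {s..t} \<Longrightarrow> norm (x \<tau>) \<le> B"
    and w: "\<And>W. chain (var_step A) s t W \<Longrightarrow> W \<le> w"
  shows "norm X \<le> B * w"
proof (rule field_le_epsilon)
  fix e :: real assume "e > 0"
  obtain \<delta> where \<delta>: "\<And>t. 0 < \<delta> t" "\<And>S. chain (KS_step A x \<delta>) s t S \<Longrightarrow> norm (S - X) < e"
    using has_KS_integral_fwdD[OF int \<open>e > 0\<close>] by blast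
  obtain S where S: "chain (KS_step A x \<delta>) s t S"
    using Cousin_fine_chain[where A = A and g = x and \<delta> = \<delta>, OF \<open>s \<le> t\<close> \<delta>(1)] by blast
  have "B \<ge> 0" using B[of s] \<open>s \<le> t\<close> norm_ge_zero[of "x s"] by (auto simp del: norm_ge_zero)
  obtain W where W: "chain (var_step A) s t W" "norm S \<le> B * W"
    using norm_KS_chain_le[OF S B] by blast
  have "norm S \<le> B * w" using W w[OF W(1)] \<open>B \<ge> 0\<close> by (meson mult_left_mono order_trans)
  moreover have "norm (S - X) < e" by (rule \<delta>(2)[OF S])
  ultimately show "norm X \<le> B * w + e"
    using norm_triangle_ineq2[of X S] by (simp add: norm_minus_commute)
qed

text \<open>A bound on (c, d) improves itself by half: x t is x s plus the integral over [s, t],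
  which is at most half the bound, and x s is as small as desired for s near c. The interval stays
  the same in the iteration, so x vanishes on it.\<close>

lemma right_sol_vanishes:
  assumes A: "bounded_var A" and sol: "right_sol A x c" and "x c = 0"
  shows "\<forall>\<^sub>F t in at_right c. x t = 0"
proof -
  have lim: "(x \<longlongrightarrow> 0) (at_right c)"
    using right_sol_tendsto[OF A sol] \<open>x c = 0\<close> by simp
  obtain d1 where d1: "d1 > c" "\<And>s t. c \<le> s \<Longrightarrow> s < t \<Longrightarrow> t \<le> d1 \<Longrightarrow> has_KS_integral_fwd A x s t (x t - x s)"
    using sol unfolding right_sol_def by blast
  obtain d2 where d2: "d2 > c" "\<And>s t W. c < s \<Longrightarrow> t \<le> d2 \<Longrightarrow> chain (var_step A) s t W \<Longrightarrow> W \<le> 1 / 2"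
    using small_variation_right[OF A, of "1 / 2" c] by auto
  have near: "\<exists>d>c. \<forall>t. c < t \<longrightarrow> t < d \<longrightarrow> norm (x t) < e" if "e > 0" for e
    using tendstoD[OF lim that] unfolding eventually_at_right_field by (simp add: dist_norm)
  obtain d3 where d3: "d3 > c" "\<And>t. c < t \<Longrightarrow> t < d3 \<Longrightarrow> norm (x t) < 1" using near[of 1] by auto
  define d where "d = min (min d1 d2) d3"
  have "norm (x t) \<le> (1 / 2) ^ n" if "c < t" "t < d" for n t
    using that
  proof (induction n arbitrary: t)
    case 0
    then show ?case using d3(2)[of t] by (simp add: d_def)
  next
    case (Suc n)
    show ?case
    proof (rule field_le_epsilon)
      fix e :: real assume "e > 0"
      obtain d' where d': "d' > c" "\<And>t. c < t \<Longrightarrow> t < d' \<Longrightarrow> norm (x t) < e" using near[OF \<open>e > 0\<close>] by auto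
      obtain s where s: "c < s" "s < min t d'" using dense[of c "min t d'"] Suc.prems d' by auto
      have "norm (x t - x s) \<le> (1 / 2) ^ n * (1 / 2)"
      proof (rule norm_KS_integral_le)
        show "has_KS_integral_fwd A x s t (x t - x s)" using d1 s Suc.prems by (simp add: d_def)
        show "norm (x \<tau>) \<le> (1 / 2) ^ n" if "\<tau> \<in> {s..t}" for \<tau>
          using Suc.IH[of \<tau>] Suc.prems that s by simp
        show "W \<le> 1 / 2" if "chain (var_step A) s t W" for W
          using d2(2)[OF s(1) _ that] Suc.prems by (simp add: d_def)
      qed (use s in simp)
      moreover have "norm (x s) < e" using d'(2) s by simp
      ultimately show "norm (x t) \<le> (1 / 2) ^ Suc n + e"
        using norm_triangle_ineq2[of "x t" "x s"] by simp
    qed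
  qed
  then have "norm (x t) \<le> 0" if "c < t" "t < d" for t
    by (intro LIMSEQ_le_const[OF LIMSEQ_power_zero[of "1 / 2 :: real"]]) (use that in auto)
  moreover have "c < d" using d1 d2 d3 by (simp add: d_def)
  ultimately show ?thesis unfolding eventually_at_right_field by auto
qed

section \<open>Uniqueness and the transition matrix\<close>

text \<open>The point \<open>c\<close> runs over all reals in both clauses, so the reflected clause
  at \<open>c\<close> is the left-hand statement at \<open>- c\<close>. Only intervals on one side
  of each point are demanded, which is enough to study the zero set.\<close>

definition local_sol :: "(real \<Rightarrow> real^'n^'n) \<Rightarrow> (real \<Rightarrow> real^'n) \<Rightarrow> bool" where
  "local_sol A x \<longleftrightarrow>
     (\<forall>c. right_sol A x c \<and> right_sol (\<lambda>t. A (- t)) (\<lambda>t. x (- t)) c)"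

lemma local_sol_reflect: "local_sol A x \<Longrightarrow> local_sol (\<lambda>t. A (- t)) (\<lambda>t. x (- t))"
  by (simp add: local_sol_def)

lemma local_sol_tendsto_right:
  assumes "bounded_var A" "local_sol A x"
  shows "(x \<longlongrightarrow> (mat 1 + jump_right A c) *v x c) (at_right c)"
  using right_sol_tendsto assms by (auto simp: local_sol_def)

lemma local_sol_tendsto_left:
  assumes "bounded_var A" "local_sol A x"
  shows "(x \<longlongrightarrow> (mat 1 - jump_left A c) *v x c) (at_left c)"
proof -
  have "((\<lambda>t. x (- t)) \<longlongrightarrow> (mat 1 + jump_right (\<lambda>t. A (- t)) (- c)) *v x (- (- c))) (at_right (- c))"
    using local_sol_tendsto_right[OF bounded_var_reflect[OF assms(1)] local_sol_reflect[OF assms(2)], of "- c"] .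
  then show ?thesis
    unfolding at_left_minus[of c] filterlim_filtermap jump_right_reflect[OF assms(1)] by simp
qed

lemma open_Collect_of_eventually_at:
  assumes "\<And>c::real. P c \<Longrightarrow> \<forall>\<^sub>F t in at c. P t"
  shows "open {t. P t}"
proof (subst open_subopen, rule ballI)
  fix c assume "c \<in> {t. P t}"
  then have "P c" by simp
  with assms[OF this] have "\<forall>\<^sub>F t in nhds c. P t" unfolding eventually_nhds_conv_at by blast
  then show "\<exists>T. open T \<and> c \<in> T \<and> T \<subseteq> {t. P t}" unfolding eventually_nhds by blast
qed

text \<open>The zero set is open, and it is closed because the one-sided limits at a point where the
  solution does not vanish are nonzero.\<close>

lemma local_sol_eq_0:
  assumes A: "bounded_var A"
    and left: "\<And>t. invertible (mat 1 - jump_left A t)"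
    and right: "\<And>t. invertible (mat 1 + jump_right A t)"
    and sol: "local_sol A x" and "x t0 = 0"
  shows "x t = 0"
proof -
  have "open {t. x t = 0}"
  proof (rule open_Collect_of_eventually_at)
    fix c assume c: "x c = 0"
    have "\<forall>\<^sub>F t in at_right c. x t = 0"
      using right_sol_vanishes[OF A, of x c] sol c by (simp add: local_sol_def)
    moreover have "\<forall>\<^sub>F t in at_right (- c). x (- t) = 0"
      using right_sol_vanishes[OF bounded_var_reflect[OF A], of "\<lambda>t. x (- t)" "- c"] sol c
      by (simp add: local_sol_def)
    ultimately show "\<forall>\<^sub>F t in at c. x t = 0"
      unfolding eventually_at_split eventually_at_left_to_right by simp
  qed
  moreover have "open {t. x t \<noteq> 0}"
  proof (rule open_Collect_of_eventually_at)
    fix c assume c: "x c \<noteq> 0"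
    have "(mat 1 + jump_right A c) *v x c \<noteq> 0" "(mat 1 - jump_left A c) *v x c \<noteq> 0"
      using invertible_mult_vec_eq_0[OF right] invertible_mult_vec_eq_0[OF left] c by blast+
    then show "\<forall>\<^sub>F t in at c. x t \<noteq> 0"
      unfolding eventually_at_split
      by (intro conjI tendsto_imp_eventually_ne[OF local_sol_tendsto_right[OF A sol]]
          tendsto_imp_eventually_ne[OF local_sol_tendsto_left[OF A sol]])
  qed
  ultimately have "{t. x t = 0} = {} \<or> {t. x t \<noteq> 0} = {}"
    using connectedD[OF connected_UNIV, of "{t. x t = 0}" "{t. x t \<noteq> 0}"] by auto
  then show ?thesis using \<open>x t0 = 0\<close> by auto
qed

section \<open>Linear combinations of solutions\<close>

lemma fine_tagged_partition_mono:
  assumes "fine_tagged_partition \<delta> a b m \<alpha> \<tau>" "\<And>t. \<delta> t \<le> \<delta>' t"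
  shows "fine_tagged_partition \<delta>' a b m \<alpha> \<tau>"
  unfolding fine_tagged_partition_def
proof (intro conjI allI impI)
  fix j assume "j < m"
  then have "{\<alpha> j..\<alpha> (Suc j)} \<subseteq> {\<tau> j - \<delta> (\<tau> j)<..<\<tau> j + \<delta> (\<tau> j)}" "\<tau> j \<in> {\<alpha> j..\<alpha> (Suc j)}"
    using assms(1) by (auto simp: fine_tagged_partition_def)
  moreover have "{\<tau> j - \<delta> (\<tau> j)<..<\<tau> j + \<delta> (\<tau> j)} \<subseteq> {\<tau> j - \<delta>' (\<tau> j)<..<\<tau> j + \<delta>' (\<tau> j)}"
    using assms(2)[of "\<tau> j"] by auto
  ultimately show "\<tau> j \<in> {\<alpha> j..\<alpha> (Suc j)}"
    "{\<alpha> j..\<alpha> (Suc j)} \<subseteq> {\<tau> j - \<delta>' (\<tau> j)<..<\<tau> j + \<delta>' (\<tau> j)}" by blast+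
qed (use assms in \<open>auto simp: fine_tagged_partition_def\<close>)

lemma has_KS_integral_fwd_add:
  assumes "has_KS_integral_fwd A g a b X" "has_KS_integral_fwd A h a b Y"
  shows "has_KS_integral_fwd A (\<lambda>t. g t + h t) a b (X + Y)"
  unfolding has_KS_integral_fwd_def
proof (intro allI impI)
  fix e :: real assume "e > 0"
  then have e: "e / 2 > 0" by simp
  define S where "S g m \<alpha> \<tau> = (\<Sum>j<m. (A (\<alpha> (Suc j)) - A (\<alpha> j)) *v g (\<tau> j))"
    for g :: "real \<Rightarrow> real^'a" and m \<alpha> \<tau>
  have *: "\<exists>\<delta>. (\<forall>t\<in>{a..b}. 0 < \<delta> t) \<and>
      (\<forall>m \<alpha> \<tau>. fine_tagged_partition \<delta> a b m \<alpha> \<tau> \<longrightarrow> norm (S g m \<alpha> \<tau> - X) < e / 2)"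
    if "has_KS_integral_fwd A g a b X" for g X
    using that[unfolded has_KS_integral_fwd_def, rule_format, OF e] unfolding S_def .
  obtain \<delta> where \<delta>: "\<forall>t\<in>{a..b}. 0 < \<delta> t"
    "\<And>m \<alpha> \<tau>. fine_tagged_partition \<delta> a b m \<alpha> \<tau> \<Longrightarrow> norm (S g m \<alpha> \<tau> - X) < e / 2"
    using *[OF assms(1)] by blast
  obtain \<delta>' where \<delta>': "\<forall>t\<in>{a..b}. 0 < \<delta>' t"
    "\<And>m \<alpha> \<tau>. fine_tagged_partition \<delta>' a b m \<alpha> \<tau> \<Longrightarrow> norm (S h m \<alpha> \<tau> - Y) < e / 2"
    using *[OF assms(2)] by blast
  show "\<exists>\<delta>. (\<forall>t\<in>{a..b}. 0 < \<delta> t) \<and> (\<forall>m \<alpha> \<tau>. fine_tagged_partition \<delta> a b m \<alpha> \<tau> \<longrightarrow>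
      norm ((\<Sum>j<m. (A (\<alpha> (Suc j)) - A (\<alpha> j)) *v (g (\<tau> j) + h (\<tau> j))) - (X + Y)) < e)"
  proof (intro exI[of _ "\<lambda>t. min (\<delta> t) (\<delta>' t)"] conjI allI impI)
    fix m \<alpha> \<tau> assume *: "fine_tagged_partition (\<lambda>t. min (\<delta> t) (\<delta>' t)) a b m \<alpha> \<tau>"
    have less: "norm (S g m \<alpha> \<tau> - X) < e / 2" "norm (S h m \<alpha> \<tau> - Y) < e / 2"
      by (rule \<delta>(2) \<delta>'(2), rule fine_tagged_partition_mono[OF *], simp)+
    have eq: "(\<Sum>j<m. (A (\<alpha> (Suc j)) - A (\<alpha> j)) *v (g (\<tau> j) + h (\<tau> j))) - (X + Y)
        = (S g m \<alpha> \<tau> - X) + (S h m \<alpha> \<tau> - Y)"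
      by (simp add: S_def matrix_vector_right_distrib sum.distrib)
    show "norm ((\<Sum>j<m. (A (\<alpha> (Suc j)) - A (\<alpha> j)) *v (g (\<tau> j) + h (\<tau> j))) - (X + Y)) < e"
      unfolding eq using norm_triangle_ineq[of "S g m \<alpha> \<tau> - X" "S h m \<alpha> \<tau> - Y"] less by linarith
  qed (use \<delta>(1) \<delta>'(1) in auto)
qed

lemma has_KS_integral_fwd_scale:
  assumes "has_KS_integral_fwd A g a b X"
  shows "has_KS_integral_fwd A (\<lambda>t. r *s g t) a b (r *s X)"
  unfolding has_KS_integral_fwd_def
proof (intro allI impI)
  fix e :: real assume "e > 0"
  \<comment> \<open>The summand 1 covers the case \<open>r = 0\<close>.\<close>
  then have e: "e / (\<bar>r\<bar> + 1) > 0" by (simp add: add_nonneg_pos)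
  define S where "S m \<alpha> \<tau> = (\<Sum>j<m. (A (\<alpha> (Suc j)) - A (\<alpha> j)) *v g (\<tau> j))"
    for m :: nat and \<alpha> \<tau>
  have "\<exists>\<delta>. (\<forall>t\<in>{a..b}. 0 < \<delta> t) \<and>
      (\<forall>m \<alpha> \<tau>. fine_tagged_partition \<delta> a b m \<alpha> \<tau> \<longrightarrow> norm (S m \<alpha> \<tau> - X) < e / (\<bar>r\<bar> + 1))"
    using assms[unfolded has_KS_integral_fwd_def, rule_format, OF e] unfolding S_def .
  then obtain \<delta> where \<delta>: "\<forall>t\<in>{a..b}. 0 < \<delta> t"
    "\<And>m \<alpha> \<tau>. fine_tagged_partition \<delta> a b m \<alpha> \<tau> \<Longrightarrow> norm (S m \<alpha> \<tau> - X) < e / (\<bar>r\<bar> + 1)"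
    by blast
  show "\<exists>\<delta>. (\<forall>t\<in>{a..b}. 0 < \<delta> t) \<and> (\<forall>m \<alpha> \<tau>. fine_tagged_partition \<delta> a b m \<alpha> \<tau> \<longrightarrow>
      norm ((\<Sum>j<m. (A (\<alpha> (Suc j)) - A (\<alpha> j)) *v (r *s g (\<tau> j))) - r *s X) < e)"
  proof (intro exI[of _ \<delta>] conjI allI impI \<delta>(1))
    fix m \<alpha> \<tau> assume *: "fine_tagged_partition \<delta> a b m \<alpha> \<tau>"
    have "(\<Sum>j<m. (A (\<alpha> (Suc j)) - A (\<alpha> j)) *v (r *s g (\<tau> j))) - r *s X
        = r *\<^sub>R (S m \<alpha> \<tau> - X)" (is "?l = r *\<^sub>R ?d")
      by (simp add: S_def scalar_mult_eq_scaleR matrix_vector_mult_scaleR scaleR_right_diff_distrib scaleR_sum_right)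
    then have "norm ?l = \<bar>r\<bar> * norm ?d" by simp
    also have "\<dots> \<le> (\<bar>r\<bar> + 1) * norm ?d" by (intro mult_right_mono) auto
    also have "\<dots> < e" using \<delta>(2)[OF *] by (simp add: pos_less_divide_eq mult.commute add_nonneg_pos)
    finally show "norm ?l < e" .
  qed
qed

lemma right_sol_add:
  assumes "right_sol A x c" "right_sol A y c"
  shows "right_sol A (\<lambda>t. x t + y t) c"
proof -
  obtain d where d: "d > c" "\<And>s t. c \<le> s \<Longrightarrow> s < t \<Longrightarrow> t \<le> d \<Longrightarrow> has_KS_integral_fwd A x s t (x t - x s)"
    using assms(1) unfolding right_sol_def by blast
  obtain d' where d': "d' > c" "\<And>s t. c \<le> s \<Longrightarrow> s < t \<Longrightarrow> t \<le> d' \<Longrightarrow> has_KS_integral_fwd A y s t (y t - y s)"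
    using assms(2) unfolding right_sol_def by blast
  show ?thesis unfolding right_sol_def
  proof (intro exI[of _ "min d d'"] conjI allI impI)
    fix s t assume st: "c \<le> s" "s < t" "t \<le> min d d'"
    then have "has_KS_integral_fwd A (\<lambda>t. x t + y t) s t ((x t - x s) + (y t - y s))"
      by (intro has_KS_integral_fwd_add d d') auto
    then show "has_KS_integral_fwd A (\<lambda>t. x t + y t) s t (x t + y t - (x s + y s))"
      by (simp add: algebra_simps)
  qed (use d d' in simp)
qed

lemma right_sol_scale:
  assumes "right_sol A x c"
  shows "right_sol A (\<lambda>t. r *s x t) c"
  using assms has_KS_integral_fwd_scale[of A x _ _ _ r] unfolding right_sol_def
  by (metis vector_ssub_ldistrib)

lemma local_sol_add: "local_sol A x \<Longrightarrow> local_sol A y \<Longrightarrow> local_sol A (\<lambda>t. x t + y t)"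
  by (simp add: local_sol_def right_sol_add)

lemma local_sol_scale: "local_sol A x \<Longrightarrow> local_sol A (\<lambda>t. r *s x t)"
  by (simp add: local_sol_def right_sol_scale)

lemma local_sol_diff:
  assumes "local_sol A x" "local_sol A y"
  shows "local_sol A (\<lambda>t. x t - y t)"
  using local_sol_add[OF assms(1) local_sol_scale[OF assms(2), of "-1"]] by simp

lemma local_sol_sum:
  assumes "finite I" "I \<noteq> {}" "\<And>i. i \<in> I \<Longrightarrow> local_sol A (x i)"
  shows "local_sol A (\<lambda>t. \<Sum>i\<in>I. x i t)"
  using assms by (induction I rule: finite_ne_induct) (auto intro: local_sol_add)

lemma local_sol_matrix_vector:
  assumes "\<And>k. local_sol A (\<lambda>t. column k (M t))"
  shows "local_sol A (\<lambda>t. M t *v v)"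
  unfolding matrix_mult_sum by (intro local_sol_sum local_sol_scale assms) auto

text \<open>Subtracting integrals with the common endpoint \<open>s\<close> gives the integral equation on every
  interval on one side of \<open>s\<close>, which suffices for a local solution.\<close>

lemma local_solI:
  assumes "\<And>t. has_KS_integral A x s t (x t - x s)"
  shows "local_sol A x"
proof -
  have right: "has_KS_integral_fwd A x a b (x b - x a)" if "s \<le> a" "a < b" for a b
  proof (cases "s = a")
    case True
    then show ?thesis using assms[of b] that by (simp add: has_KS_integral_def)
  next
    case False
    then have "has_KS_integral_fwd A x s b (x b - x s)" "has_KS_integral_fwd A x s a (x a - x s)"
      using assms[of b] assms[of a] that by (auto simp: has_KS_integral_def)
    from has_KS_integral_fwd_diff_left[OF this] that show ?thesis by simp
  qed
  have left: "has_KS_integral_fwd A x a b (x b - x a)" if "b \<le> s" "a < b" for a b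
  proof (cases "s = b")
    case True
    then show ?thesis using assms[of a] that by (simp add: has_KS_integral_def)
  next
    case False
    then have "has_KS_integral_fwd A x a s (x s - x a)" "has_KS_integral_fwd A x b s (x s - x b)"
      using assms[of b] assms[of a] that by (auto simp: has_KS_integral_def)
    from has_KS_integral_fwd_diff_right[OF this] that show ?thesis by simp
  qed
  have refl: "has_KS_integral_fwd (\<lambda>t. A (- t)) (\<lambda>t. x (- t)) a b (x (- b) - x (- a))"
    if "has_KS_integral_fwd A x (- b) (- a) (x (- a) - x (- b))" for a b
    using has_KS_integral_fwd_reflect[OF that] by simp
  have "right_sol A x c" for c
  proof (cases "s \<le> c")
    case True
    then show ?thesis unfolding right_sol_def
      by (intro exI[of _ "c + 1"] conjI allI impI right) auto
  next
    \<comment> \<open>The neighbourhood has to end at \<open>s\<close>, because \<open>left\<close>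
      and \<open>right\<close> give the equation only on intervals lying on one side of
      \<open>s\<close>.\<close>
    case False
    then show ?thesis unfolding right_sol_def
      by (intro exI[of _ s] conjI allI impI left) auto
  qed
  moreover have "right_sol (\<lambda>t. A (- t)) (\<lambda>t. x (- t)) c" for c
  proof (cases "- s \<le> c")
    case True
    then show ?thesis unfolding right_sol_def
      by (intro exI[of _ "c + 1"] conjI allI impI refl left) auto
  next
    case False
    then show ?thesis unfolding right_sol_def
      by (intro exI[of _ "- s"] conjI allI impI refl right) auto
  qed
  ultimately show ?thesis by (simp add: local_sol_def)
qed

lemma transition_matrix_self:
  assumes "is_transition_matrix A U"
  shows "U s s = mat 1"
proof -
  obtain X where X: "has_KS_integral_matrix A (\<lambda>r. U r s) s s X" "U s s = mat 1 + X"
    using assms unfolding is_transition_matrix_def by blast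
  have "column k X = 0" for k using X(1) by (simp add: has_KS_integral_matrix_def has_KS_integral_def)
  then have "X = 0" by (simp add: vec_eq_iff column_def)
  with X show ?thesis by simp
qed

lemma local_sol_transition:
  assumes "is_transition_matrix A U"
  shows "local_sol A (\<lambda>t. U t s *v v)"
proof (intro local_sol_matrix_vector local_solI)
  fix k t
  obtain X where X: "has_KS_integral_matrix A (\<lambda>r. U r s) s t X" "U t s = mat 1 + X"
    using assms unfolding is_transition_matrix_def by blast
  have "column k X = column k (U t s) - column k (U s s)"
    unfolding transition_matrix_self[OF assms] X(2) by (simp add: vec_eq_iff column_def)
  then show "has_KS_integral A (\<lambda>t. column k (U t s)) s t (column k (U t s) - column k (U s s))"
    using X(1) unfolding has_KS_integral_matrix_def by metis
qed

section \<open>Translation by a period\<close>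

lemma chain_shift:
  assumes "chain R a b X" "\<And>s t x. R s t x \<Longrightarrow> R' (s + w) (t + w) x"
  shows "chain R' (a + w) (b + w) X"
  using assms by (induction rule: chain.induct) (auto intro: chain.intros)

text \<open>Only increments of \<open>A\<close> enter the sums, and a constant difference
  \<open>C\<close> makes them periodic even though \<open>A\<close> itself need not be. Tags and
  gauge are translated along.\<close>

lemma has_KS_integral_fwd_shift:
  assumes A: "\<And>t. A (t + w) - A t = C" and "has_KS_integral_fwd A x (a + w) (b + w) X"
  shows "has_KS_integral_fwd A (\<lambda>t. x (t + w)) a b X"
  unfolding has_KS_integral_fwd_iff
proof (intro allI impI)
  fix e :: real assume "e > 0"
  obtain \<delta> where \<delta>: "\<And>t. 0 < \<delta> t" "\<And>S. chain (KS_step A x \<delta>) (a + w) (b + w) S \<Longrightarrow> norm (S - X) < e"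
    using has_KS_integral_fwdD[OF assms(2) \<open>e > 0\<close>] by blast
  have step: "KS_step A x \<delta> (s + w) (t + w) y" if step': "KS_step A (\<lambda>t. x (t + w)) (\<lambda>t. \<delta> (t + w)) s t y" for s t y
  proof -
    obtain \<tau> where \<tau>: "\<tau> \<in> {s..t}" "{s..t} \<subseteq> {\<tau> - \<delta> (\<tau> + w)<..<\<tau> + \<delta> (\<tau> + w)}"
      "y = (A t - A s) *v x (\<tau> + w)"
      using step' unfolding KS_step_def by blast
    have "s \<in> {s..t}" "t \<in> {s..t}" using \<tau>(1) by auto
    then have "\<tau> - \<delta> (\<tau> + w) < s" "t < \<tau> + \<delta> (\<tau> + w)" using \<tau>(2) by fastforce+
    moreover have "A (t + w) - A (s + w) = A t - A s" using A[of t] A[of s] by (simp add: algebra_simps)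
    ultimately show ?thesis
      using \<tau>(1,3) unfolding KS_step_def by (intro bexI[of _ "\<tau> + w"]) auto
  qed
  show "\<exists>\<delta>. (\<forall>t. 0 < \<delta> t) \<and> (\<forall>S. chain (KS_step A (\<lambda>t. x (t + w)) \<delta>) a b S \<longrightarrow> norm (S - X) < e)"
  proof (intro exI[of _ "\<lambda>t. \<delta> (t + w)"] conjI allI)
    show "0 < \<delta> (t + w)" for t by (rule \<delta>(1))
    show "chain (KS_step A (\<lambda>t. x (t + w)) (\<lambda>t. \<delta> (t + w))) a b S \<longrightarrow> norm (S - X) < e" for S
      using \<delta>(2) chain_shift[where R' = "KS_step A x \<delta>", OF _ step] by blast
  qed
qed

lemma right_sol_shift:
  assumes A: "\<And>t. A (t + w) - A t = C" and "right_sol A x (c + w)"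
  shows "right_sol A (\<lambda>t. x (t + w)) c"
proof -
  obtain d where d: "d > c + w" "\<And>s t. c + w \<le> s \<Longrightarrow> s < t \<Longrightarrow> t \<le> d \<Longrightarrow> has_KS_integral_fwd A x s t (x t - x s)"
    using assms(2) unfolding right_sol_def by blast
  show ?thesis unfolding right_sol_def
  proof (intro exI[of _ "d - w"] conjI allI impI)
    show "has_KS_integral_fwd A (\<lambda>t. x (t + w)) s t (x (t + w) - x (s + w))"
      if "c \<le> s" "s < t" "t \<le> d - w" for s t
      using that by (intro has_KS_integral_fwd_shift[where A = A and w = w, OF A] d) auto
  qed (use d in simp)
qed

lemma local_sol_shift:
  assumes A: "\<And>t. A (t + w) - A t = C" and sol: "local_sol A x"
  shows "local_sol A (\<lambda>t. x (t + w))"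
proof -
  have "right_sol A (\<lambda>t. x (t + w)) c" for c
    using sol by (intro right_sol_shift[where A = A and w = w, OF A]) (simp add: local_sol_def)
  \<comment> \<open>In reversed time the shift is \<open>- w\<close>, and the increment of the
    reflected coefficient over it is again \<open>C\<close>.\<close>
  moreover have "right_sol (\<lambda>t. A (- t)) (\<lambda>t. x (- (t + (- w)))) c" for c
  proof (rule right_sol_shift[where A = "\<lambda>t. A (- t)" and x = "\<lambda>t. x (- t)"])
    show "A (- (t + (- w))) - A (- t) = C" for t using A[of "- t"] by simp
    show "right_sol (\<lambda>t. A (- t)) (\<lambda>t. x (- t)) (c + - w)" using sol by (simp add: local_sol_def)
  qed
  ultimately show ?thesis by (simp add: local_sol_def)
qed

section \<open>Transition matrices: uniqueness, invertibility and bounds\<close>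

text \<open>Bisection again, with \<open>max\<close> joining bounds. Punctured one-sided
  neighbourhoods allow for discontinuities of \<open>f\<close>; the value at the point itself is
  added to the bound separately.\<close>

lemma local_bound_imp_bound:
  fixes f :: "real \<Rightarrow> real"
  assumes "a \<le> b" "\<And>c. \<exists>B. (\<forall>\<^sub>F t in at_left c. f t \<le> B) \<and> (\<forall>\<^sub>F t in at_right c. f t \<le> B)"
  shows "\<exists>B. \<forall>t\<in>{a..b}. f t \<le> B"
  using assms(1)
proof (induction rule: Bolzano)
  case (trans a b c)
  then obtain B1 B2 where "\<forall>t\<in>{a..b}. f t \<le> B1" "\<forall>t\<in>{b..c}. f t \<le> B2" by blast
  then have "f t \<le> max B1 B2" if "t \<in> {a..c}" for t
    using that by (cases "t \<le> b") (auto simp: le_max_iff_disj)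
  then show ?case by blast
next
  case (local c)
  obtain B where "\<forall>\<^sub>F t in at c. f t \<le> B" using assms(2)[of c] unfolding eventually_at_split by blast
  then obtain d where d: "d > 0" "\<And>t. t \<noteq> c \<Longrightarrow> dist t c < d \<Longrightarrow> f t \<le> B"
    unfolding eventually_at by auto
  have "f t \<le> max B (f c)" if "a \<le> c \<and> c \<le> b \<and> b - a < d" "t \<in> {a..b}" for a b t
    using d(2)[of t] that by (cases "t = c") (auto simp: dist_real_def le_max_iff_disj)
  with \<open>d > 0\<close> show ?case by blast
qed

lemma tendsto_matrix_columns:
  fixes M :: "real \<Rightarrow> real^'n^'n"
  assumes "\<And>v. ((\<lambda>t. M t *v v) \<longlongrightarrow> L *v v) F"
  shows "(M \<longlongrightarrow> L) F"
proof (intro vec_tendstoI)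
  fix i j
  have *: "N $ i $ j = (N *v axis j 1) $ i" for N :: "real^'n^'n"
    by (simp add: matrix_vector_mul_component column_def inner_axis matrix_vector_mult_basis)
  show "((\<lambda>t. M t $ i $ j) \<longlongrightarrow> L $ i $ j) F"
    unfolding * by (intro tendsto_vec_nth assms)
qed

text \<open>Inversion stays bounded near an invertible limit. The threshold 1 / 2 is the one of
  \<open>op_norm_matrix_inv_le\<close>, while the margin 1 for the matrix itself is
  arbitrary.\<close>

lemma eventually_op_norm_bound:
  fixes M :: "real \<Rightarrow> real^'n^'n"
  assumes lim: "(M \<longlongrightarrow> L) F" and inv: "invertible L" "\<And>t. invertible (M t)"
  shows "\<exists>B. \<forall>\<^sub>F t in F. max (op_norm (M t)) (op_norm (matrix_inv (M t))) \<le> B"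
proof -
  let ?n = "op_norm (matrix_inv L)"
  have "((\<lambda>t. op_norm (M t - L) * ?n) \<longlongrightarrow> 0) F"
    using tendsto_mult_left_zero[OF op_norm_tendsto_zero[OF lim]] .
  then have 1: "\<forall>\<^sub>F t in F. op_norm (M t - L) * ?n < 1 / 2" by (rule order_tendstoD) simp
  have 2: "\<forall>\<^sub>F t in F. op_norm (M t - L) < 1"
    using op_norm_tendsto_zero[OF lim] by (rule order_tendstoD) simp
  have "\<forall>\<^sub>F t in F. max (op_norm (M t)) (op_norm (matrix_inv (M t))) \<le> max (op_norm L + 1) (2 * ?n)"
    using 1 2
  proof eventually_elim
    case (elim t)
    have "op_norm (M t) \<le> op_norm (M t - L) + op_norm L" using op_norm_add[of "M t - L" L] by simp
    moreover have "op_norm (matrix_inv (M t)) \<le> 2 * ?n"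
      using op_norm_matrix_inv_le[OF inv(2) inv(1)] elim(1) by simp
    ultimately show ?case using elim(2) by linarith
  qed
  then show ?thesis by blast
qed

context
  fixes A :: "real \<Rightarrow> real^'n^'n"
  assumes A: "bounded_var A"
    and inv_left: "\<And>t. invertible (mat 1 - jump_left A t)"
    and inv_right: "\<And>t. invertible (mat 1 + jump_right A t)"
begin

lemma local_sol_unique:
  assumes "local_sol A x" "local_sol A y" "x t0 = y t0"
  shows "x t = y t"
  using local_sol_eq_0[OF A inv_left inv_right local_sol_diff[OF assms(1,2)], of t0 t] assms(3) by simp

text \<open>The dichotomy is stated with an existentially quantified transition matrix; this
  identifies it with the given one.\<close>

lemma transition_matrix_unique:
  assumes "is_transition_matrix A U" "is_transition_matrix A U'"
  shows "U t s = U' t s"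
proof -
  have "U t s *v v = U' t s *v v" for v
    by (rule local_sol_unique[of "\<lambda>t. U t s *v v" "\<lambda>t. U' t s *v v" s])
      (simp_all add: local_sol_transition assms transition_matrix_self[OF assms(1)] transition_matrix_self[OF assms(2)])
  then show ?thesis by (simp add: matrix_eq)
qed

text \<open>If the solution starting from \<open>v\<close> at \<open>s\<close> vanishes at
  \<open>t\<close>, it vanishes at all times, in particular at \<open>s\<close>, where its value is
  \<open>v\<close>.\<close>

lemma invertible_transition_matrix:
  assumes U: "is_transition_matrix A U"
  shows "invertible (U t s)"
proof -
  have "v = 0" if "U t s *v v = 0" for v
    using local_sol_unique[where x = "\<lambda>t. U t s *v v" and y = "\<lambda>t. U t s *v 0" and ?t0.0 = t and t = s,
        OF local_sol_transition[OF U] local_sol_transition[OF U]] that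
    by (simp only: transition_matrix_self[OF U] matrix_vector_mult_0_right matrix_vector_mul_lid)
  then show ?thesis using matrix_left_invertible_ker invertible_left_inverse by blast
qed

text \<open>Applied to a vector, both sides are solutions, the left one by translation invariance,
  and they agree at t = 0.\<close>

lemma transition_matrix_shift:
  assumes U: "is_transition_matrix A U" and period: "\<And>t. A (t + \<omega>) - A t = C"
  shows "U (t + \<omega>) 0 = U t 0 ** U \<omega> 0"
proof -
  have "U (t + \<omega>) 0 *v v = U t 0 *v (U \<omega> 0 *v v)" for v
  proof (rule local_sol_unique[where x = "\<lambda>t. U (t + \<omega>) 0 *v v" and y = "\<lambda>t. U t 0 *v (U \<omega> 0 *v v)"
        and ?t0.0 = 0])
    show "local_sol A (\<lambda>t. U (t + \<omega>) 0 *v v)"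
      using local_sol_shift[where A = A and w = \<omega>, OF period local_sol_transition[OF U]] .
    show "local_sol A (\<lambda>t. U t 0 *v (U \<omega> 0 *v v))" by (rule local_sol_transition[OF U])
    show "U (0 + \<omega>) 0 *v v = U 0 0 *v (U \<omega> 0 *v v)" by (simp add: transition_matrix_self[OF U])
  qed
  then show ?thesis by (simp add: matrix_eq matrix_vector_mul_assoc)
qed

text \<open>\<open>U\<close> may jump, but its one-sided limits at \<open>c\<close> are
  \<open>U c s\<close> times an invertible jump factor. They are therefore invertible, which bounds
  the matrix and its inverse on either side of every point.\<close>

lemma transition_matrix_bounded:
  assumes U: "is_transition_matrix A U" and "a \<le> b"
  shows "\<exists>B. \<forall>t\<in>{a..b}. op_norm (U t s) \<le> B \<and> op_norm (matrix_inv (U t s)) \<le> B"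
proof -
  define f where "f t = max (op_norm (U t s)) (op_norm (matrix_inv (U t s)))" for t
  have "\<exists>B. \<forall>t\<in>{a..b}. f t \<le> B"
  proof (rule local_bound_imp_bound[OF \<open>a \<le> b\<close>])
    fix c
    have lim: "((\<lambda>t. U t s) \<longlongrightarrow> (mat 1 - jump_left A c) ** U c s) (at_left c)"
      "((\<lambda>t. U t s) \<longlongrightarrow> (mat 1 + jump_right A c) ** U c s) (at_right c)"
      using local_sol_tendsto_left[OF A local_sol_transition[OF U]]
        local_sol_tendsto_right[OF A local_sol_transition[OF U]]
      by (auto intro!: tendsto_matrix_columns simp: matrix_vector_mul_assoc[symmetric])
    note inv = invertible_transition_matrix[OF U]
    obtain B1 where "\<forall>\<^sub>F t in at_left c. f t \<le> B1"
      using eventually_op_norm_bound[OF lim(1) invertible_mult[OF inv_left inv] inv] unfolding f_def by blast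
    moreover obtain B2 where "\<forall>\<^sub>F t in at_right c. f t \<le> B2"
      using eventually_op_norm_bound[OF lim(2) invertible_mult[OF inv_right inv] inv] unfolding f_def by blast
    ultimately have "\<forall>\<^sub>F t in at_left c. f t \<le> max B1 B2" "\<forall>\<^sub>F t in at_right c. f t \<le> max B1 B2"
      by (auto elim: eventually_mono)
    then show "\<exists>B. (\<forall>\<^sub>F t in at_left c. f t \<le> B) \<and> (\<forall>\<^sub>F t in at_right c. f t \<le> B)" by blast
  qed
  then show ?thesis by (simp add: f_def)
qed

end

section \<open>Hyperbolic matrices\<close>

primrec mpow :: "('a::semiring_1)^'n^'n \<Rightarrow> nat \<Rightarrow> 'a^'n^'n" where
  "mpow M 0 = mat 1"
| "mpow M (Suc k) = M ** mpow M k"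

lemma mpow_commute: "mpow M k ** M = M ** mpow M k"
  by (induction k) (simp_all add: matrix_mul_assoc[symmetric])

lemma mpow_vector_Suc: "mpow M (Suc k) *v x = mpow M k *v (M *v x)"
  by (simp add: matrix_vector_mul_assoc mpow_commute)

lemma mpow_inverse:
  fixes M N :: "'a::field^'n^'n"
  assumes "N ** M = mat 1"
  shows "mpow N k ** mpow M k = mat 1"
proof (induction k)
  case (Suc k)
  have "mpow N (Suc k) ** mpow M (Suc k) = mpow N k ** (N ** M) ** mpow M k"
    using mpow_commute[of N k] by (simp add: matrix_mul_assoc)
  with Suc assms show ?case by simp
qed simp

text \<open>\<open>annihilated T [\<lambda>\<^sub>1, \<dots>, \<lambda>\<^sub>m] v\<close> means \<open>(T - \<lambda>\<^sub>m) \<cdots> (T - \<lambda>\<^sub>1) v = 0\<close>.\<close>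

primrec annihilated :: "('a::field)^'n^'n \<Rightarrow> 'a list \<Rightarrow> 'a^'n \<Rightarrow> bool" where
  "annihilated T [] v \<longleftrightarrow> v = 0"
| "annihilated T (l # ls) v \<longleftrightarrow> annihilated T ls (T *v v - l *s v)"

lemmas vec_linear_simps = matrix_vector_right_distrib matrix_vector_mult_diff_distrib
  vector_scalar_commute vector_add_ldistrib vector_ssub_ldistrib vector_sadd_rdistrib vector_sub_rdistrib
  vector_smult_assoc

lemma annihilated_0 [simp]: "annihilated T ls 0"
  by (induction ls) simp_all

lemma annihilated_add: "annihilated T ls v \<Longrightarrow> annihilated T ls w \<Longrightarrow> annihilated T ls (v + w)"
proof (induction ls arbitrary: v w)
  case (Cons l ls)
  then have "annihilated T ls ((T *v v - l *s v) + (T *v w - l *s w))" by simp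
  then show ?case by (simp add: vec_linear_simps algebra_simps)
qed simp

lemma annihilated_scale: "annihilated T ls v \<Longrightarrow> annihilated T ls (c *s v)"
proof (induction ls arbitrary: v)
  case (Cons l ls)
  have "annihilated T ls (c *s (T *v v - l *s v))"
    by (rule Cons.IH) (use Cons.prems in simp)
  then show ?case by (simp add: vec_linear_simps mult.commute)
qed simp

lemma annihilated_diff: "annihilated T ls v \<Longrightarrow> annihilated T ls w \<Longrightarrow> annihilated T ls (v - w)"
proof -
  have "v - w = v + (- 1) *s w" by (simp add: vec_eq_iff)
  moreover assume "annihilated T ls v" "annihilated T ls w"
  ultimately show ?thesis by (metis annihilated_add annihilated_scale)
qed

lemma annihilated_apply: "annihilated T ls v \<Longrightarrow> annihilated T ls (T *v v)"
proof (induction ls arbitrary: v)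
  case (Cons l ls)
  have "annihilated T ls (T *v (T *v v - l *s v))"
    by (rule Cons.IH) (use Cons.prems in simp)
  then show ?case by (simp add: vec_linear_simps)
qed simp

lemma annihilated_shift: "annihilated T ls v \<Longrightarrow> annihilated T ls (T *v v - m *s v)"
  by (intro annihilated_diff annihilated_apply annihilated_scale)

lemma annihilated_append_left: "annihilated T ls v \<Longrightarrow> annihilated T (ls' @ ls) v"
  by (induction ls' arbitrary: v) (auto intro: annihilated_shift)

lemma annihilated_append_right: "annihilated T ls v \<Longrightarrow> annihilated T (ls @ ls') v"
  by (induction ls arbitrary: v) auto

text \<open>Each factor T - m acts on \<open>v\<close> as the nonzero scalar l - m.\<close>

lemma annihilated_eigenvector:
  assumes "annihilated T ls v" "T *v v = l *s v" "l \<notin> set ls"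
  shows "v = 0"
  using assms
proof (induction ls arbitrary: v)
  case (Cons m ls)
  then have "annihilated T ls ((l - m) *s v)" by (simp add: vec_linear_simps)
  then have "annihilated T ls (inverse (l - m) *s ((l - m) *s v))" by (rule annihilated_scale)
  moreover have "inverse (l - m) *s ((l - m) *s v) = v"
    using Cons.prems by (subst vector_smult_assoc) auto
  ultimately have "annihilated T ls v" by (simp only:)
  then show ?case using Cons by simp
qed simp

text \<open>By induction (T - l) v = 0, as it is killed by the shorter list and still by
  \<open>ms\<close>. So \<open>v\<close> would be an eigenvector for a value outside
  \<open>ms\<close>.\<close>

lemma annihilated_disjoint:
  assumes "annihilated T ls v" "annihilated T ms v" "set ls \<inter> set ms = {}"
  shows "v = 0"
  using assms
proof (induction ls arbitrary: v)
  case (Cons l ls)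
  have "T *v v - l *s v = 0"
    using Cons by (intro Cons.IH) (auto intro: annihilated_shift)
  then show ?case using annihilated_eigenvector[of T ms v l] Cons.prems by auto
qed simp

text \<open>\<open>T - l\<close> is invertible on the space annihilated by \<open>\<Prod>(T - m)\<close> when \<open>l\<close> is not among the \<open>m\<close>.
  The inverse comes from \<open>(T - m) b - (T - l) b = (l - m) b\<close>.\<close>

lemma annihilated_solve:
  assumes "annihilated T ms b" "l \<notin> set ms"
  shows "\<exists>b'. T *v b' - l *s b' = b \<and> annihilated T ms b'"
  using assms
proof (induction ms arbitrary: b)
  case Nil
  then show ?case by (intro exI[of _ 0]) simp
next
  case (Cons m ms)
  define c where "c = T *v b - m *s b"
  have lm: "l - m \<noteq> 0" using Cons.prems by auto
  have c: "annihilated T ms c" using Cons.prems by (simp add: c_def)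
  then obtain c' where c': "T *v c' - l *s c' = c" "annihilated T ms c'" using Cons by auto
  define b' where "b' = inverse (l - m) *s (c' - b)"
  have "T *v b' - l *s b' = inverse (l - m) *s ((T *v c' - l *s c') - (T *v b - l *s b))"
    by (simp add: b'_def vec_linear_simps mult.commute)
  also have "(T *v c' - l *s c') - (T *v b - l *s b) = (l - m) *s b"
    by (simp add: c'(1) c_def vec_linear_simps)
  also have "inverse (l - m) *s \<dots> = b" by (subst vector_smult_assoc) (use lm in simp)
  finally have 1: "T *v b' - l *s b' = b" .
  have "T *v b' - m *s b' = inverse (l - m) *s ((T *v c' - m *s c') - c)"
    by (simp add: b'_def c_def vec_linear_simps mult.commute)
  moreover have "annihilated T ms (inverse (l - m) *s ((T *v c' - m *s c') - c))"
    using c c'(2) by (intro annihilated_scale annihilated_diff[OF _ c] annihilated_shift)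
  ultimately have "annihilated T (m # ms) b'" by (simp only: annihilated.simps)
  with 1 show ?case by blast
qed

text \<open>Primary decomposition, vector by vector. Split (T - l) v by induction. The part on the
  side that does not receive \<open>l\<close> is pulled back through T - l by
  \<open>annihilated_solve\<close>; what remains of \<open>v\<close> takes the extra factor
  \<open>l\<close>.\<close>

lemma annihilated_split:
  assumes "annihilated T ls v"
  shows "\<exists>a b. v = a + b \<and> annihilated T (filter Q ls) a \<and> annihilated T (filter (\<lambda>l. \<not> Q l) ls) b"
  using assms
proof (induction ls arbitrary: v)
  case (Cons l ls)
  then obtain a b where ab: "T *v v - l *s v = a + b"
    "annihilated T (filter Q ls) a" "annihilated T (filter (\<lambda>l. \<not> Q l) ls) b"
    by (metis annihilated.simps(2))
  show ?case
  proof (cases "Q l")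
    case True
    then obtain b' where b': "T *v b' - l *s b' = b" "annihilated T (filter (\<lambda>l. \<not> Q l) ls) b'"
      using annihilated_solve[OF ab(3), of l] by auto
    have "T *v (v - b') - l *s (v - b') = a" using ab(1) b'(1) by (simp add: vec_linear_simps algebra_simps)
    with True b' ab show ?thesis by (intro exI[of _ "v - b'"] exI[of _ b']) simp
  next
    case False
    then obtain a' where a': "T *v a' - l *s a' = a" "annihilated T (filter Q ls) a'"
      using annihilated_solve[OF ab(2), of l] by auto
    have "T *v (v - a') - l *s (v - a') = b" using ab(1) a'(1) by (simp add: vec_linear_simps algebra_simps)
    with False a' ab show ?thesis by (intro exI[of _ a'] exI[of _ "v - a'"]) simp
  qed
qed simp

definition eigenvalue :: "('a::field)^'n^'n \<Rightarrow> 'a \<Rightarrow> bool" where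
  "eigenvalue T l \<longleftrightarrow> (\<exists>v. v \<noteq> 0 \<and> T *v v = l *s v)"

text \<open>If \<open>l\<close> is not an eigenvalue, T - l is injective. It commutes with the other
  factors, so it can be cancelled at the end of the product.\<close>

lemma annihilated_remove:
  assumes "annihilated T ls (T *v v - l *s v)" "\<not> eigenvalue T l"
  shows "annihilated T ls v"
  using assms(1)
proof (induction ls arbitrary: v)
  case Nil
  then show ?case using assms(2) by (auto simp: eigenvalue_def)
next
  case (Cons m ls)
  have "annihilated T ls (T *v (T *v v - m *s v) - l *s (T *v v - m *s v))"
    using Cons.prems by (simp add: vec_linear_simps algebra_simps)
  from Cons.IH[OF this] show ?case by simp
qed

lemma annihilated_filter_eigenvalue:
  "annihilated T ls v \<Longrightarrow> annihilated T (filter (eigenvalue T) ls) v"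
  by (induction ls arbitrary: v) (auto intro: annihilated_remove)

text \<open>A root \<open>l\<close> gives p = (X - l) q, and q(T) kills (T - l) v, so the roots of p
  are peeled off one by one. The bound \<open>N\<close> instead of the exact degree keeps the index
  range of the sums independent of p.\<close>

lemma polynomial_imp_annihilated:
  fixes T :: "complex^'n^'n"
  assumes "p \<noteq> 0" "degree p < N" "(\<Sum>i<N. coeff p i *s (mpow T i *v v)) = 0"
  shows "\<exists>ls. annihilated T ls v"
  using assms
proof (induction N arbitrary: p v)
  case (Suc N)
  show ?case
  proof (cases "degree p = 0")
    case True
    then obtain c where "p = [:c:]" using degree_eq_zeroE by blast
    then have "v = 0" using Suc.prems by (simp add: sum.lessThan_Suc_shift del: sum.lessThan_Suc)
    then show ?thesis by (intro exI[of _ "[]"]) simp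
  next
    case False
    then obtain l where "poly p l = 0"
      using fundamental_theorem_of_algebra constant_degree by metis
    then obtain q where p: "p = [:- l, 1:] * q" unfolding poly_eq_0_iff_dvd by (auto elim: dvdE)
    with Suc.prems have "q \<noteq> 0" by auto
    then have "degree p = Suc (degree q)" unfolding p by (subst degree_mult_eq) auto
    with Suc.prems have deg: "degree q < N" by simp
    \<comment> \<open>Allows the sum of the terms \<open>l * coeff q i\<close> to be padded to
      \<open>Suc N\<close> terms and combined with that of \<open>pCons 0 q\<close>
      termwise.\<close>
    have "coeff q N = 0" using deg by (rule coeff_eq_0)
    have "(\<Sum>i<N. coeff q i *s (mpow T i *v (T *v v - l *s v)))
        = (\<Sum>i<N. coeff q i *s (mpow T (Suc i) *v v)) - (\<Sum>i<N. (l * coeff q i) *s (mpow T i *v v))"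
      by (simp add: mpow_vector_Suc vec_linear_simps sum_subtractf mult.commute del: mpow.simps)
    also have "(\<Sum>i<N. coeff q i *s (mpow T (Suc i) *v v)) = (\<Sum>i<Suc N. coeff (pCons 0 q) i *s (mpow T i *v v))"
      by (simp add: sum.lessThan_Suc_shift coeff_pCons del: sum.lessThan_Suc)
    also have "(\<Sum>i<N. (l * coeff q i) *s (mpow T i *v v)) = (\<Sum>i<Suc N. (l * coeff q i) *s (mpow T i *v v))"
      using \<open>coeff q N = 0\<close> by simp
    also have "(\<Sum>i<Suc N. coeff (pCons 0 q) i *s (mpow T i *v v)) - \<dots> = (\<Sum>i<Suc N. coeff p i *s (mpow T i *v v))"
      unfolding sum_subtractf[symmetric] p by (intro sum.cong) (simp_all add: vec_linear_simps)
    finally have "(\<Sum>i<N. coeff q i *s (mpow T i *v (T *v v - l *s v))) = 0" using Suc.prems by simp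
    then obtain ls where "annihilated T ls (T *v v - l *s v)" using Suc.IH \<open>q \<noteq> 0\<close> deg by blast
    then show ?thesis by (intro exI[of _ "l # ls"]) simp
  qed
qed simp

text \<open>Dependence is a notion for sets, so a repeated value is treated apart, by the relation f
  j - f i = 0. Otherwise \<open>CARD('n) + 1\<close> distinct vectors exceed the dimension.\<close>

lemma linear_dependence_sequence:
  fixes f :: "nat \<Rightarrow> 'a::field^'n"
  shows "\<exists>N c. (\<exists>i<N. c i \<noteq> 0) \<and> (\<Sum>i<N. c i *s f i) = 0"
proof (cases "inj_on f {..<Suc CARD('n)}")
  case True
  define S where "S = f ` {..<Suc CARD('n)}"
  have "card S = Suc CARD('n)" unfolding S_def using True by (simp add: card_image)
  moreover have "vec.dim S \<le> CARD('n)"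
    using vec.dim_subset[of S UNIV] card_cart_basis[where 'i = 'n and 'a = 'a] by (simp add: vec.dim_UNIV)
  ultimately have "vec.dependent S" by (intro vec.dependent_biggerset_general) simp
  moreover have "finite S" by (simp add: S_def)
  ultimately obtain u where "\<exists>v\<in>S. u v \<noteq> 0" "(\<Sum>v\<in>S. u v *s v) = 0"
    using vec.dependent_finite by blast
  then show ?thesis
    using True unfolding S_def
    by (intro exI[of _ "Suc CARD('n)"] exI[of _ "u \<circ> f"]) (auto simp: sum.reindex)
next
  case False
  then obtain i j where ij: "i < j" "f i = f j" by (metis inj_onI linorder_neqE_nat)
  define c :: "nat \<Rightarrow> 'a" where "c k = (if k = j then 1 else 0) - (if k = i then 1 else 0)" for k
  have eq: "c k *s f k = (if k = j then f j else 0) - (if k = i then f i else 0)" for k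
    using ij by (simp add: c_def vec_linear_simps)
  have "(\<Sum>k<Suc j. c k *s f k) = 0"
    unfolding eq sum_subtractf using ij by simp
  then show ?thesis using ij by (intro exI[of _ "Suc j"] exI[of _ c] conjI exI[of _ j]) (auto simp: c_def)
qed

text \<open>The iterates T^i v are dependent, which is a polynomial relation for this one
  \<open>v\<close>. Factoring it and dropping the roots that are not eigenvalues leaves the list,
  which depends on \<open>v\<close>.\<close>

lemma annihilated_exists:
  fixes T :: "complex^'n^'n"
  obtains ls where "\<And>l. l \<in> set ls \<Longrightarrow> eigenvalue T l" "annihilated T ls v"
proof -
  obtain N c i where c: "i < N" "c i \<noteq> 0" "(\<Sum>i<N. c i *s (mpow T i *v v)) = 0"
    using linear_dependence_sequence[of "\<lambda>i. mpow T i *v v"] by blast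
  define p where "p = (\<Sum>i<N. monom (c i) i)"
  have coeff: "coeff p k = (if k < N then c k else 0)" for k
    by (simp add: p_def coeff_sum coeff_monom)
  have "p \<noteq> 0" using coeff[of i] c by auto
  moreover have "degree p < N"
    using c(1) coeff by (intro le_less_trans[OF degree_le[of "N - 1"]]) auto
  moreover have "(\<Sum>i<N. coeff p i *s (mpow T i *v v)) = 0" using c(3) by (simp add: coeff)
  ultimately obtain ls where "annihilated T ls v" using polynomial_imp_annihilated by blast
  then show ?thesis
    using that[of "filter (eigenvalue T) ls"] annihilated_filter_eigenvalue by auto
qed

lemma norm_vector_scale: "norm (c *s (v :: complex^'n)) = cmod c * norm v"
  by (simp add: norm_vec_def norm_mult L2_set_right_distrib)

text \<open>With w = (T - l) v one has T^(k+1) v = T^k w + l T^k v, a scalar recursion along the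
  list. The strict gap between \<open>cmod l\<close> and \<open>r\<close> absorbs the polynomial
  factors in k that a Jordan block would produce.\<close>

lemma annihilated_power_bound:
  fixes T :: "complex^'n^'n"
  assumes "annihilated T ls v" "\<forall>l\<in>set ls. cmod l < r" "0 < r"
  shows "\<exists>B. \<forall>k. norm (mpow T k *v v) \<le> B * r ^ k"
  using assms(1,2)
proof (induction ls arbitrary: v)
  case Nil
  then show ?case by (intro exI[of _ 0]) simp
next
  case (Cons l ls)
  define w where "w = T *v v - l *s v"
  obtain B where B: "\<And>k. norm (mpow T k *v w) \<le> B * r ^ k"
    using Cons.IH[of w] Cons.prems by (auto simp: w_def)
  have l: "cmod l < r" using Cons.prems by simp
  \<comment> \<open>Chosen so that \<open>B + cmod l * B' \<le> r * B'\<close>, which closes the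
    induction on k; \<open>norm v\<close> serves k = 0.\<close>
  define B' where "B' = max (norm v) (B / (r - cmod l))"
  have "norm v \<le> B'" "B / (r - cmod l) \<le> B'" by (simp_all add: B'_def)
  then have B': "norm v \<le> B'" "B \<le> (r - cmod l) * B'"
    using l by (simp_all add: pos_divide_le_eq mult.commute)
  have "norm (mpow T k *v v) \<le> B' * r ^ k" for k
  proof (induction k)
    case (Suc k)
    have "mpow T (Suc k) *v v = mpow T k *v w + l *s (mpow T k *v v)"
      unfolding mpow_vector_Suc w_def by (simp add: vec_linear_simps)
    then have "norm (mpow T (Suc k) *v v) \<le> norm (mpow T k *v w) + cmod l * norm (mpow T k *v v)"
      by (metis norm_triangle_ineq norm_vector_scale)
    also have "\<dots> \<le> B * r ^ k + cmod l * (B' * r ^ k)"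
      by (intro add_mono B mult_left_mono Suc) simp
    also have "\<dots> = (B + cmod l * B') * r ^ k" by (simp add: algebra_simps)
    also have "\<dots> \<le> (r * B') * r ^ k"
      using B' assms(3) by (intro mult_right_mono) (auto simp: algebra_simps)
    finally show ?case by (simp add: algebra_simps)
  qed (use B' in simp)
  then show ?case by blast
qed

lemma annihilated_decay:
  fixes T :: "complex^'n^'n"
  assumes "annihilated T ls v" "\<forall>l\<in>set ls. cmod l < 1"
  shows "\<exists>B r. 0 < r \<and> r < 1 \<and> (\<forall>k. norm (mpow T k *v v) \<le> B * r ^ k)"
proof -
  have "\<exists>r. 0 < r \<and> r < 1 \<and> (\<forall>l\<in>set ls. cmod l < r)"
    using assms(2)
  proof (induction ls)
    case Nil
    then show ?case by (intro exI[of _ "1/2"]) simp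
  next
    case (Cons l ls)
    then obtain r where "0 < r" "r < 1" "\<forall>l\<in>set ls. cmod l < r" by auto
    moreover obtain s where "cmod l < s" "s < 1" using Cons.prems dense[of "cmod l" 1] by auto
    ultimately show ?case by (intro exI[of _ "max r s"]) (auto simp: less_max_iff_disj)
  qed
  with annihilated_power_bound[OF assms(1)] show ?thesis by blast
qed

text \<open>(T' - 1/l) v = -(1/l) T' (T - l) v, and applying T' preserves annihilation by factors of
  T'.\<close>

lemma annihilated_inverse:
  assumes "T' ** T = mat 1" "0 \<notin> set ls" "annihilated T ls v"
  shows "annihilated T' (map inverse ls) v"
  using assms(2,3)
proof (induction ls arbitrary: v)
  case (Cons l ls)
  then have "annihilated T' (map inverse ls) ((- inverse l) *s (T' *v (T *v v - l *s v)))"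
    by (intro annihilated_scale annihilated_apply) auto
  moreover have "T' *v (T *v v) = v" by (simp add: matrix_vector_mul_assoc assms(1))
  ultimately show ?case
    using Cons.prems by (simp add: vec_linear_simps)
qed simp

section \<open>Real vectors inside the complex space and spectral parts\<close>

definition cvec :: "real^'n \<Rightarrow> complex^'n" where
  "cvec x = (\<chi> i. complex_of_real (x $ i))"

definition cmat :: "real^'n^'n \<Rightarrow> complex^'n^'n" where
  "cmat = map_matrix complex_of_real"

lemma cvec_0 [simp]: "cvec 0 = 0"
  and cvec_add: "cvec (x + y) = cvec x + cvec y"
  and cvec_scale: "cvec (c *s x) = complex_of_real c *s cvec x"
  by (simp_all add: cvec_def vec_eq_iff)

lemma cvec_eq_0_iff [simp]: "cvec x = 0 \<longleftrightarrow> x = 0"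
  by (simp add: cvec_def vec_eq_iff)

lemma cmat_cvec: "cmat M *v cvec x = cvec (M *v x)"
  by (simp add: cmat_def cvec_def vec_eq_iff matrix_vector_mult_def)

lemma cmat_mult: "cmat (M ** N) = cmat M ** cmat N"
  by (simp add: cmat_def vec_eq_iff matrix_matrix_mult_def)

lemma cmat_1 [simp]: "cmat (mat 1) = mat 1"
  by (simp add: cmat_def vec_eq_iff mat_def)

lemma mpow_cmat_cvec: "mpow (cmat M) k *v cvec x = cvec (mpow M k *v x)"
proof (induction k)
  case (Suc k)
  then show ?case by (simp add: cmat_cvec matrix_vector_mul_assoc[symmetric])
qed simp

lemma norm_cvec [simp]: "norm (cvec x) = norm x"
  by (simp add: cvec_def norm_vec_def)

lemma annihilated_cnj:
  assumes "annihilated (cmat M) ls v"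
  shows "annihilated (cmat M) (map cnj ls) (\<chi> i. cnj (v $ i))"
  using assms
proof (induction ls arbitrary: v)
  case (Cons l ls)
  have "annihilated (cmat M) (map cnj ls) (\<chi> i. cnj ((cmat M *v v - l *s v) $ i))"
    by (rule Cons.IH) (use Cons.prems in simp)
  moreover have "(\<chi> i. cnj ((cmat M *v v - l *s v) $ i))
      = cmat M *v (\<chi> i. cnj (v $ i)) - cnj l *s (\<chi> i. cnj (v $ i))"
    by (simp add: cmat_def vec_eq_iff matrix_vector_mult_def)
  ultimately show ?case by simp
qed (simp add: vec_eq_iff)

text \<open>The real vectors in the sum of the generalized eigenspaces for eigenvalues in
  \<open>Q\<close>. The list may depend on \<open>x\<close>, and entries that are no eigenvalues add
  nothing, since their factors are injective.\<close>

definition spectral_part :: "real^'n^'n \<Rightarrow> (complex \<Rightarrow> bool) \<Rightarrow> real^'n \<Rightarrow> bool" where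
  "spectral_part M Q x \<longleftrightarrow> (\<exists>ls. (\<forall>l\<in>set ls. Q l) \<and> annihilated (cmat M) ls (cvec x))"

lemma spectral_part_0: "spectral_part M Q 0"
  unfolding spectral_part_def by (rule exI[of _ "[]"]) simp

lemma spectral_part_add:
  assumes "spectral_part M Q x" "spectral_part M Q y"
  shows "spectral_part M Q (x + y)"
proof -
  obtain ls ms where "\<forall>l\<in>set ls. Q l" "annihilated (cmat M) ls (cvec x)"
    "\<forall>l\<in>set ms. Q l" "annihilated (cmat M) ms (cvec y)"
    using assms unfolding spectral_part_def by blast
  then show ?thesis unfolding spectral_part_def
    by (intro exI[of _ "ls @ ms"])
      (auto simp: cvec_add intro!: annihilated_add intro: annihilated_append_left annihilated_append_right)
qed

lemma spectral_part_scale: "spectral_part M Q x \<Longrightarrow> spectral_part M Q (c *s x)"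
  unfolding spectral_part_def by (auto simp: cvec_scale intro: annihilated_scale)

lemma spectral_part_diff:
  assumes "spectral_part M Q x" "spectral_part M Q y"
  shows "spectral_part M Q (x - y)"
  using spectral_part_add[OF assms(1) spectral_part_scale[OF assms(2), of "-1"]] by simp

lemma spectral_part_sum:
  "(\<And>i. i \<in> I \<Longrightarrow> spectral_part M Q (x i)) \<Longrightarrow> spectral_part M Q (\<Sum>i\<in>I. x i)"
  by (induction I rule: infinite_finite_induct) (auto intro: spectral_part_0 spectral_part_add)

lemma spectral_part_apply: "spectral_part M Q x \<Longrightarrow> spectral_part M Q (M *v x)"
  unfolding spectral_part_def by (auto simp: cmat_cvec[symmetric] intro: annihilated_apply)

lemma spectral_part_disjoint:
  assumes "spectral_part M Q x" "spectral_part M R x" "\<And>l. Q l \<Longrightarrow> \<not> R l"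
  shows "x = 0"
proof -
  obtain ls ms where "\<forall>l\<in>set ls. Q l" "annihilated (cmat M) ls (cvec x)"
    "\<forall>l\<in>set ms. R l" "annihilated (cmat M) ms (cvec x)"
    using assms unfolding spectral_part_def by blast
  then have "cvec x = 0" using assms(3) by (intro annihilated_disjoint[of _ ls _ ms]) auto
  then show ?thesis by simp
qed

text \<open>The real part is half the sum of \<open>a\<close> and its conjugate. As \<open>M\<close>
  is real, the conjugate is annihilated by the conjugated list, which stays in
  \<open>Q\<close>.\<close>

lemma spectral_part_Re:
  assumes "\<forall>l\<in>set ls. Q l" "annihilated (cmat M) ls a" "\<And>l. Q l \<Longrightarrow> Q (cnj l)"
  shows "spectral_part M Q (\<chi> i. Re (a $ i))"
proof -
  have "cvec (\<chi> i. Re (a $ i)) = (1 / 2) *s (a + (\<chi> i. cnj (a $ i)))"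
    by (simp add: cvec_def vec_eq_iff complex_eq_iff)
  moreover have "annihilated (cmat M) (ls @ map cnj ls) ((1 / 2) *s (a + (\<chi> i. cnj (a $ i))))"
    using assms(2) by (intro annihilated_scale annihilated_add annihilated_append_left annihilated_append_right annihilated_cnj)
  ultimately have "annihilated (cmat M) (ls @ map cnj ls) (cvec (\<chi> i. Re (a $ i)))" by (simp only:)
  then show ?thesis unfolding spectral_part_def
    using assms(1,3) by (intro exI[of _ "ls @ map cnj ls"]) auto
qed

text \<open>Split \<open>cvec x\<close> over the complex numbers and take real parts; they still add
  up to \<open>x\<close> because \<open>x\<close> is real.\<close>

lemma spectral_part_split:
  assumes "\<And>l. eigenvalue (cmat M) l \<Longrightarrow> Q l \<or> R l" "\<And>l. Q l \<Longrightarrow> Q (cnj l)" "\<And>l. R l \<Longrightarrow> R (cnj l)"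
  shows "\<exists>a b. x = a + b \<and> spectral_part M Q a \<and> spectral_part M R b"
proof -
  obtain ls where ls: "\<And>l. l \<in> set ls \<Longrightarrow> eigenvalue (cmat M) l" "annihilated (cmat M) ls (cvec x)"
    using annihilated_exists[of "cmat M" "cvec x"] by blast
  obtain a b where ab: "cvec x = a + b" "annihilated (cmat M) (filter Q ls) a"
    "annihilated (cmat M) (filter (\<lambda>l. \<not> Q l) ls) b"
    using annihilated_split[OF ls(2)] by blast
  have "spectral_part M Q (\<chi> i. Re (a $ i))" by (rule spectral_part_Re[OF _ ab(2)]) (use assms in auto)
  moreover have "spectral_part M R (\<chi> i. Re (b $ i))"
    by (rule spectral_part_Re[OF _ ab(3)]) (use assms ls(1) in auto)
  moreover have "x = (\<chi> i. Re (a $ i)) + (\<chi> i. Re (b $ i))"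
    using ab(1) by (simp add: cvec_def vec_eq_iff complex_eq_iff)
  ultimately show ?thesis by blast
qed

text \<open>Rates may vary with the vector, but finitely many unit vectors control all entries: the
  largest of their rates and the sum of their constants work for the whole matrix.\<close>

lemma uniform_decay:
  fixes f :: "nat \<Rightarrow> real^'n^'n"
  assumes "\<And>x. \<exists>B r. 0 < r \<and> r < 1 \<and> (\<forall>k. norm (f k *v x) \<le> B * r ^ k)"
  shows "\<exists>B r. 0 < r \<and> r < 1 \<and> 0 < B \<and> (\<forall>k. op_norm (f k) \<le> B * r ^ k)"
proof -
  obtain B r where Br: "\<And>x. 0 < r x" "\<And>x. r x < 1" "\<And>x k. norm (f k *v x) \<le> B x * r x ^ k"
    using assms by metis
  define r' where "r' = Max (range (\<lambda>j::'n. r (axis j 1)))"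
  define B' where "B' = (\<Sum>j::'n\<in>UNIV. \<bar>B (axis j 1)\<bar>)"
  have le: "r (axis j 1) \<le> r'" "\<bar>B (axis j 1)\<bar> \<le> B'" for j
    by (auto simp: r'_def B'_def intro: member_le_sum)
  have r': "0 < r'" "r' < 1"
    using le(1) Br(1) less_le_trans apply blast
    unfolding r'_def using Br(2) by (subst Max_less_iff) auto
  have "op_norm (f k) \<le> real CARD('n) * real CARD('n) * (B' * r' ^ k)" for k
  proof (rule op_norm_le_entries)
    fix i j
    have "\<bar>f k $ i $ j\<bar> \<le> norm (f k *v axis j 1)"
      using component_le_norm_cart[of "f k *v axis j 1" i] by (simp add: matrix_vector_mult_basis column_def)
    also have "\<dots> \<le> B (axis j 1) * r (axis j 1) ^ k" by (rule Br)
    also have "\<dots> \<le> B' * r' ^ k"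
      using le[of j] Br(1)[of "axis j 1"] by (intro mult_mono power_mono) auto
    finally show "\<bar>f k $ i $ j\<bar> \<le> B' * r' ^ k" .
  qed
  \<comment> \<open>The summand 1 makes the constant positive even if \<open>B'\<close> is
    0.\<close>
  also have "real CARD('n) * real CARD('n) * (B' * r' ^ k) \<le> (real CARD('n) * real CARD('n) * B' + 1) * r' ^ k" for k
    using r' by (simp add: algebra_simps)
  finally have "op_norm (f k) \<le> (real CARD('n) * real CARD('n) * B' + 1) * r' ^ k" for k .
  moreover have "0 < real CARD('n) * real CARD('n) * B' + 1"
    unfolding B'_def by (intro add_nonneg_pos mult_nonneg_nonneg sum_nonneg) auto
  ultimately show ?thesis using r' by blast
qed

text \<open>The columns of \<open>P\<close> are the inside parts of the unit vectors. The inside and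
  outside parts meet only in 0, so \<open>P\<close> is the projection onto one along the other, and
  it commutes with \<open>M\<close> because \<open>M\<close> preserves both. On the outside part it
  is the inverse that contracts, through the reciprocal factors.\<close>

theorem hyperbolic_splitting:
  fixes M :: "real^'n^'n"
  assumes inv: "invertible M" and hyp: "\<And>l. complex_eigenvalue M l \<Longrightarrow> cmod l \<noteq> 1"
  shows "\<exists>P B r. P ** P = P \<and> P ** M = M ** P \<and> 0 < r \<and> r < 1 \<and> 0 < B \<and>
    (\<forall>k. op_norm (mpow M k ** P) \<le> B * r ^ k) \<and>
    (\<forall>k. op_norm (mpow (matrix_inv M) k ** (mat 1 - P)) \<le> B * r ^ k)"
proof -
  define S where "S = spectral_part M (\<lambda>l. cmod l < 1)"
  define R where "R = spectral_part M (\<lambda>l. cmod l > 1)"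
  have hyp': "cmod l < 1 \<or> cmod l > 1" if "eigenvalue (cmat M) l" for l
    using hyp[of l] that unfolding complex_eigenvalue_def eigenvalue_def cmat_def by (auto simp: neq_iff)
  have "\<exists>a b. axis j 1 = a + b \<and> S a \<and> R b" for j :: 'n
    unfolding S_def R_def by (rule spectral_part_split) (use hyp' in auto)
  then obtain a b where ab: "\<And>j::'n. axis j 1 = a j + b j" "\<And>j. S (a j)" "\<And>j. R (b j)"
    by metis
  define P :: "real^'n^'n" where "P = (\<chi> i j. a j $ i)"
  have Pv: "P *v x = (\<Sum>j\<in>UNIV. x $ j *s a j)" for x
    by (simp add: P_def matrix_mult_sum column_def vec_lambda_eta)
  have S: "S (P *v x)" for x
    unfolding Pv S_def by (intro spectral_part_sum spectral_part_scale) (use ab(2) S_def in simp)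
  have "x - P *v x = (\<Sum>j\<in>UNIV. x $ j *s b j)" for x
  proof -
    have "x = (\<Sum>j\<in>UNIV. x $ j *s (a j + b j))"
      using basis_expansion[of x] by (simp add: ab(1)[symmetric])
    then have "x = (\<Sum>j\<in>UNIV. x $ j *s a j) + (\<Sum>j\<in>UNIV. x $ j *s b j)"
      by (simp add: vec_linear_simps sum.distrib)
    then show ?thesis unfolding Pv by (metis add_diff_cancel_left')
  qed
  then have R: "R (x - P *v x)" for x
    unfolding R_def by (simp only:) (intro spectral_part_sum spectral_part_scale, use ab(3) R_def in simp)
  \<comment> \<open>The difference P (s + t) - s is inside, and also outside, being t minus the
    outside part of s + t.\<close>
  have uniq: "P *v (s + t) = s" if "S s" "R t" for s t
  proof -
    have "P *v (s + t) - s = 0"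
    proof (rule spectral_part_disjoint)
      show "spectral_part M (\<lambda>l. cmod l < 1) (P *v (s + t) - s)"
        by (rule spectral_part_diff[OF S[unfolded S_def] that(1)[unfolded S_def]])
      have "P *v (s + t) - s = t - ((s + t) - P *v (s + t))" by simp
      with spectral_part_diff[OF that(2)[unfolded R_def] R[unfolded R_def, of "s + t"]]
      show "spectral_part M (\<lambda>l. cmod l > 1) (P *v (s + t) - s)" by (simp only:)
    qed simp
    then show ?thesis by simp
  qed
  have "R 0" unfolding R_def by (rule spectral_part_0)
  then have PP: "P *v (P *v x) = P *v x" for x using uniq[OF S, of 0] by simp
  have MS: "S (M *v x)" if "S x" for x using that unfolding S_def by (rule spectral_part_apply)
  have MR: "R (M *v x)" if "R x" for x using that unfolding R_def by (rule spectral_part_apply)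
  have PM: "P *v (M *v x) = M *v (P *v x)" for x
    using uniq[OF MS[OF S[of x]] MR[OF R[of x]]] by (simp add: matrix_vector_right_distrib[symmetric])
  have "\<exists>B r. 0 < r \<and> r < 1 \<and> (\<forall>k. norm ((mpow M k ** P) *v x) \<le> B * r ^ k)" for x
  proof -
    obtain ls where "\<forall>l\<in>set ls. cmod l < 1" "annihilated (cmat M) ls (cvec (P *v x))"
      using S[of x] unfolding S_def spectral_part_def by blast
    from annihilated_decay[OF this(2,1)] show ?thesis
      by (simp add: mpow_cmat_cvec matrix_vector_mul_assoc[symmetric])
  qed
  from uniform_decay[OF this] obtain B1 r1 where 1: "0 < r1" "r1 < 1" "0 < B1"
    "\<And>k. op_norm (mpow M k ** P) \<le> B1 * r1 ^ k" by blast
  have "\<exists>B r. 0 < r \<and> r < 1 \<and> (\<forall>k. norm ((mpow (matrix_inv M) k ** (mat 1 - P)) *v x) \<le> B * r ^ k)" for x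
  proof -
    obtain ls where ls: "\<forall>l\<in>set ls. cmod l > 1" "annihilated (cmat M) ls (cvec (x - P *v x))"
      using R[of x] unfolding R_def spectral_part_def by blast
    have "annihilated (cmat (matrix_inv M)) (map inverse ls) (cvec (x - P *v x))"
      using ls by (intro annihilated_inverse) (auto simp: cmat_mult[symmetric] matrix_inv_works inv)
    moreover have "\<forall>l\<in>set (map inverse ls). cmod l < 1"
      using ls(1) by (auto simp: norm_inverse intro: inverse_less_1_iff[THEN iffD2])
    ultimately show ?thesis using annihilated_decay[of "cmat (matrix_inv M)"]
      by (fastforce simp: mpow_cmat_cvec matrix_vector_mul_assoc[symmetric] matrix_vector_mult_diff_rdistrib)
  qed
  from uniform_decay[OF this] obtain B2 r2 where 2: "0 < r2" "r2 < 1" "0 < B2"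
    "\<And>k. op_norm (mpow (matrix_inv M) k ** (mat 1 - P)) \<le> B2 * r2 ^ k" by blast
  define B r where "B = max B1 B2" and "r = max r1 r2"
  have le: "B1 * r1 ^ k \<le> B * r ^ k" "B2 * r2 ^ k \<le> B * r ^ k" for k
    using 1 2 unfolding B_def r_def by (auto intro!: mult_mono power_mono)
  have "0 < r" "r < 1" "0 < B" using 1 2 by (simp_all add: B_def r_def)
  moreover have "\<forall>k. op_norm (mpow M k ** P) \<le> B * r ^ k"
    "\<forall>k. op_norm (mpow (matrix_inv M) k ** (mat 1 - P)) \<le> B * r ^ k"
    using order_trans[OF 1(4) le(1)] order_trans[OF 2(4) le(2)] by blast+
  moreover have "P ** P = P" "P ** M = M ** P"
    using PP PM by (simp_all add: matrix_eq matrix_vector_mul_assoc[symmetric])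
  ultimately show ?thesis by blast
qed

section \<open>The dichotomy criterion\<close>

lemma mpow_commuting:
  fixes M X :: "'a::semiring_1^'n^'n"
  assumes "X ** M = M ** X"
  shows "X ** mpow M k = mpow M k ** X"
proof (induction k)
  case (Suc k)
  have "X ** mpow M (Suc k) = M ** (X ** mpow M k)" by (simp add: matrix_mul_assoc assms)
  with Suc show ?case by (simp add: matrix_mul_assoc)
qed simp

lemma matrix_inv_mult:
  fixes M N :: "real^'n^'n"
  assumes "invertible M" "invertible N"
  shows "matrix_inv (M ** N) = matrix_inv N ** matrix_inv M"
proof (rule matrix_inv_eqI)
  have "matrix_inv N ** matrix_inv M ** (M ** N) = matrix_inv N ** (matrix_inv M ** M) ** N"
    by (simp add: matrix_mul_assoc)
  then show "matrix_inv N ** matrix_inv M ** (M ** N) = mat 1"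
    by (simp add: matrix_inv_works assms)
qed

text \<open>A real matrix acts separately on real and imaginary parts. This carries the dichotomy
  estimates, stated for real operator norms, over to complex eigenvectors.\<close>

lemma norm_cmat_vector_le:
  fixes X :: "real^'n^'n"
  shows "norm (cmat X *v v) \<le> op_norm X * (norm (\<chi> i. Re (v $ i)) + norm (\<chi> i. Im (v $ i)))"
proof -
  let ?a = "\<chi> i. Re (v $ i)" and ?b = "\<chi> i. Im (v $ i)"
  have "v = cvec ?a + \<i> *s cvec ?b" by (simp add: cvec_def vec_eq_iff complex_eq_iff)
  then have "cmat X *v v = cvec (X *v ?a) + \<i> *s cvec (X *v ?b)"
    by (metis cmat_cvec matrix_vector_right_distrib vector_scalar_commute)
  then have "norm (cmat X *v v) \<le> norm (X *v ?a) + norm (X *v ?b)"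
    using norm_triangle_ineq[of "cvec (X *v ?a)" "\<i> *s cvec (X *v ?b)"] by (simp add: norm_vector_scale)
  also have "\<dots> \<le> op_norm X * norm ?a + op_norm X * norm ?b"
    by (intro add_mono norm_matrix_vector_le)
  finally show ?thesis by (simp add: algebra_simps)
qed

text \<open>\<open>Q N\<^sup>k v = \<mu>\<^sup>k Q v\<close> has constant norm in \<open>k\<close>.\<close>

lemma unit_eigenvector_in_kernel:
  fixes Q N :: "real^'n^'n"
  assumes eig: "cmat N *v v = \<mu> *s v" and "cmod \<mu> = 1"
    and le: "\<And>k. op_norm (Q ** mpow N k) \<le> f k" and lim: "f \<longlonglongrightarrow> 0"
  shows "cmat Q *v v = 0"
proof -
  define c where "c = norm (\<chi> i. Re (v $ i)) + norm (\<chi> i. Im (v $ i))"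
  have pow: "cmat (mpow N k) *v v = \<mu> ^ k *s v" for k
  proof (induction k)
    case (Suc k)
    have "cmat (mpow N (Suc k)) *v v = cmat N *v (cmat (mpow N k) *v v)"
      by (simp add: cmat_mult matrix_vector_mul_assoc)
    also have "\<dots> = \<mu> ^ k *s (\<mu> *s v)" by (simp only: Suc vector_scalar_commute eig)
    finally show ?case by (simp add: vector_smult_assoc mult.commute)
  qed simp
  have "norm (cmat Q *v v) \<le> f k * c" for k
  proof -
    have "cmat (Q ** mpow N k) *v v = cmat Q *v (cmat (mpow N k) *v v)"
      by (simp add: cmat_mult matrix_vector_mul_assoc)
    also have "\<dots> = \<mu> ^ k *s (cmat Q *v v)" by (simp only: pow vector_scalar_commute)
    finally have "norm (cmat Q *v v) = norm (cmat (Q ** mpow N k) *v v)"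
      by (simp add: norm_vector_scale norm_power assms(2))
    also have "\<dots> \<le> op_norm (Q ** mpow N k) * c" unfolding c_def by (rule norm_cmat_vector_le)
    also have "\<dots> \<le> f k * c" by (intro mult_right_mono le) (simp add: c_def)
    finally show ?thesis .
  qed
  moreover have "(\<lambda>k. f k * c) \<longlonglongrightarrow> 0" by (rule tendsto_mult_left_zero[OF lim])
  ultimately have "norm (cmat Q *v v) \<le> 0" by (intro LIMSEQ_le_const) auto
  then show ?thesis by simp
qed

section \<open>Division of times by the period\<close>

lemma real_div_period:
  fixes x w :: real
  assumes "0 < w"
  obtains l :: int and y where "x = y + of_int l * w" "0 \<le> y" "y < w"
proof
  show "x = (x - of_int \<lfloor>x / w\<rfloor> * w) + of_int \<lfloor>x / w\<rfloor> * w" by simp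
  have "of_int \<lfloor>x / w\<rfloor> \<le> x / w" "x / w < of_int \<lfloor>x / w\<rfloor> + 1" by linarith+
  with assms show "0 \<le> x - of_int \<lfloor>x / w\<rfloor> * w" "x - of_int \<lfloor>x / w\<rfloor> * w < w"
    by (simp_all add: pos_le_divide_eq pos_divide_less_eq algebra_simps del: of_int_floor_le)
qed

lemma nonneg_real_div_period:
  fixes x w :: real
  assumes "0 < w" "0 \<le> x"
  obtains k :: nat and y where "x = y + of_nat k * w" "0 \<le> y" "y < w"
proof -
  obtain l :: int and y where ly: "x = y + of_int l * w" "0 \<le> y" "y < w" by (rule real_div_period[OF assms(1)])
  have "(of_int l + 1) * w > 0" using assms ly by (simp add: algebra_simps)
  then have "real_of_int l + 1 > 0" using assms by (simp add: zero_less_mult_iff)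
  then have "l \<ge> 0" by linarith
  with ly show ?thesis using that[of y "nat l"] by simp
qed

lemma periodic_int_shift:
  fixes G :: "real \<Rightarrow> real \<Rightarrow> 'a"
  assumes "\<And>t s. G (t + w) (s + w) = G t s"
  shows "G (t + of_int l * w) (s + of_int l * w) = G t s"
proof -
  have nat: "G (t + of_nat n * w) (s + of_nat n * w) = G t s" for t s n
  proof (induction n)
    case (Suc n)
    then show ?case
      using assms[of "t + of_nat n * w" "s + of_nat n * w"] by (simp add: algebra_simps)
  qed simp
  show ?thesis
  proof (cases l rule: int_cases2)
    case (nonneg n)
    then show ?thesis using nat by simp
  next
    case (nonpos n)
    then show ?thesis using nat[of "t - of_nat n * w" n "s - of_nat n * w"] by simp
  qed
qed

theorem theorem3p3:
  fixes A :: "real \<Rightarrow> real^'n^'n" and C :: "real^'n^'n" and \<omega> :: real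
    and U :: "real \<Rightarrow> real \<Rightarrow> real^'n^'n"
  assumes "locally_bounded_variation A"
    and "\<And>t. invertible (mat 1 - jump_left A t)"
    and "\<And>t. invertible (mat 1 + jump_right A t)"
    and "\<omega> > 0"
    and "\<And>t. A (t + \<omega>) - A t = C"
    and "is_transition_matrix A U"
  shows "admits_exponential_dichotomy A \<longleftrightarrow>
    (\<forall>\<mu>. complex_eigenvalue (U \<omega> 0) \<mu> \<longrightarrow> cmod \<mu> \<noteq> 1)"
proof -
  note A = locally_bounded_variation_imp_bounded_var[OF assms(1)]
  note invs = assms(2,3)
  note U = assms(6)
  define V where "V t = U t 0" for t
  define M where "M = V \<omega>"
  have V0: "V 0 = mat 1" unfolding V_def by (rule transition_matrix_self[OF U])
  have invV: "invertible (V t)" for t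
    unfolding V_def by (rule invertible_transition_matrix[OF A invs U])
  have invM: "invertible M" unfolding M_def by (rule invV)
  have shift: "V (t + \<omega>) = V t ** M" for t
    unfolding V_def M_def by (rule transition_matrix_shift[OF A invs U assms(5)])
  have shift_pow: "V (t + of_nat k * \<omega>) = V t ** mpow M k" for t k
  proof (induction k)
    case (Suc k)
    have "V (t + of_nat (Suc k) * \<omega>) = V (t + of_nat k * \<omega>) ** M"
      using shift[of "t + of_nat k * \<omega>"] by (simp add: algebra_simps)
    with Suc show ?case by (simp add: matrix_mul_assoc[symmetric] mpow_commute)
  qed simp
  define N where "N = matrix_inv M"
  have NM: "N ** M = mat 1" "M ** N = mat 1" by (simp_all add: N_def matrix_inv_works invM)
  have inv_mpow: "matrix_inv (mpow M k) = mpow N k" for k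
    by (rule matrix_inv_eqI[OF mpow_inverse[OF NM(1)]])
  show ?thesis
  proof
    assume "admits_exponential_dichotomy A"
    then obtain U' K \<alpha> and P :: "real^'n^'n" where U': "is_transition_matrix A U'"
      and K: "K > 0" "\<alpha> > 0"
      and st: "\<And>t s. t \<ge> s \<Longrightarrow> op_norm (U' t 0 ** P ** matrix_inv (U' s 0)) \<le> K * exp (- \<alpha> * (t - s))"
      and un: "\<And>t s. s \<ge> t \<Longrightarrow> op_norm (U' t 0 ** (mat 1 - P) ** matrix_inv (U' s 0)) \<le> K * exp (- \<alpha> * (s - t))"
      unfolding admits_exponential_dichotomy_def by blast
    have U'_eq: "U' t 0 = V t" for t
      unfolding V_def by (rule transition_matrix_unique[OF A invs U' U])
    show "\<forall>\<mu>. complex_eigenvalue (U \<omega> 0) \<mu> \<longrightarrow> cmod \<mu> \<noteq> 1"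
    proof (intro allI impI notI)
      fix \<mu> assume "complex_eigenvalue (U \<omega> 0) \<mu>" and \<mu>: "cmod \<mu> = 1"
      then obtain v where v: "v \<noteq> 0" "cmat M *v v = \<mu> *s v"
        unfolding complex_eigenvalue_def cmat_def M_def V_def by blast
      have "\<mu> \<noteq> 0" using \<mu> by auto
      have "cmat N *v (cmat M *v v) = v"
        by (simp add: matrix_vector_mul_assoc cmat_mult[symmetric] NM)
      then have "\<mu> *s (cmat N *v v) = v" unfolding v(2) by (simp only: vector_scalar_commute)
      then have Nv: "cmat N *v v = inverse \<mu> *s v"
        using \<open>\<mu> \<noteq> 0\<close> by (metis vector_smult_assoc left_inverse vector_smult_lid)
      define f where "f k = K * exp (- \<alpha> * (real k * \<omega>))" for k
      have "(\<lambda>k. K * exp (- \<alpha> * \<omega>) ^ k) \<longlonglongrightarrow> K * 0"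
        using K assms(4) by (intro tendsto_intros LIMSEQ_power_zero) auto
      then have f: "f \<longlonglongrightarrow> 0"
        unfolding f_def by (simp add: exp_of_nat_mult[symmetric] mult_ac)
      \<comment> \<open>Going back k periods inverts M^k. The stable estimate at (0, -k \<omega>)
        thus bounds \<open>P ** mpow M k\<close>, and the unstable one at (0, k \<omega>) bounds
        \<open>(mat 1 - P) ** mpow N k\<close>.\<close>
      have "V (- (of_nat k * \<omega>)) ** mpow M k = mat 1" for k
        using shift_pow[of "- (of_nat k * \<omega>)" k] V0 by simp
      then have inv1: "matrix_inv (V (- (of_nat k * \<omega>))) = mpow M k" for k
        by (intro matrix_inv_eqI) (simp add: matrix_left_right_inverse)
      have "cmat P *v v = 0"
      proof (rule unit_eigenvector_in_kernel[OF v(2) \<mu> _ f])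
        show "op_norm (P ** mpow M k) \<le> f k" for k
          using st[of "- (of_nat k * \<omega>)" 0] assms(4) by (simp add: U'_eq V0 inv1 f_def)
      qed
      moreover have "cmat (mat 1 - P) *v v = 0"
      proof (rule unit_eigenvector_in_kernel[OF Nv _ _ f])
        show "op_norm ((mat 1 - P) ** mpow N k) \<le> f k" for k
          using un[of 0 "of_nat k * \<omega>"] assms(4) shift_pow[of 0 k]
          by (simp add: U'_eq V0 inv_mpow f_def)
      qed (use \<mu> in \<open>simp add: norm_inverse\<close>)
      moreover have "cmat (mat 1 - P) = mat 1 - cmat P"
        by (simp add: cmat_def vec_eq_iff mat_def)
      ultimately have "v = 0" by (simp add: matrix_vector_mult_diff_rdistrib)
      with v(1) show False by simp
    qed
  next
    assume "\<forall>\<mu>. complex_eigenvalue (U \<omega> 0) \<mu> \<longrightarrow> cmod \<mu> \<noteq> 1"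
    then have hyp: "cmod \<mu> \<noteq> 1" if "complex_eigenvalue M \<mu>" for \<mu> using that by (simp add: M_def V_def)
    obtain P B r where P: "P ** P = P" "P ** M = M ** P" and r: "0 < r" "r < 1" and B: "0 < B"
      and st: "\<And>k. op_norm (mpow M k ** P) \<le> B * r ^ k"
      and un: "\<And>k. op_norm (mpow N k ** (mat 1 - P)) \<le> B * r ^ k"
      using hyperbolic_splitting[OF invM hyp] unfolding N_def by blast
    obtain D where D: "\<And>t. t \<in> {0..\<omega>} \<Longrightarrow> op_norm (V t) \<le> D \<and> op_norm (matrix_inv (V t)) \<le> D"
      using transition_matrix_bounded[OF A invs U less_imp_le[OF assms(4)], of 0] unfolding V_def by blast
    have "D \<ge> 0" using D[of 0] op_norm_nonneg[of "V 0"] assms(4) by auto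
    \<comment> \<open>Shifting both times by one period replaces X by M X N between the outer
      factors, which is X again when X commutes with \<open>M\<close>.\<close>
    define G where "G X t s = V t ** X ** matrix_inv (V s)" for X t s
    have G: "G X (t + of_int l * \<omega>) (s + of_int l * \<omega>) = G X t s" if "X ** M = M ** X" for X t s l
    proof (rule periodic_int_shift)
      fix t s
      have "M ** X ** N = X" using that by (metis NM(2) matrix_mul_assoc matrix_mul_rid)
      then show "G X (t + \<omega>) (s + \<omega>) = G X t s"
        unfolding G_def shift matrix_inv_mult[OF invV invM] N_def[symmetric]
        by (metis matrix_mul_assoc)
    qed
    define Q where "Q = mat 1 - P"
    have QM: "Q ** M = M ** Q"
    proof -
      have "Q ** M + M ** P = M ** Q + M ** P"
        using matrix_add_rdistrib[of Q P M] matrix_add_ldistrib[of M Q P] by (simp add: Q_def P(2))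
      then show ?thesis by simp
    qed
    have "N ** (Q ** M) ** N = N ** (M ** Q) ** N" by (simp add: QM)
    then have QN: "Q ** N = N ** Q" by (metis NM matrix_mul_assoc matrix_mul_lid matrix_mul_rid)
    \<comment> \<open>That is, r = exp (-\<alpha> \<omega>): contraction per period turned into a
      rate per unit of time.\<close>
    define \<alpha> where "\<alpha> = - ln r / \<omega>"
    have \<alpha>: "\<alpha> > 0" using r assms(4) by (simp add: \<alpha>_def divide_neg_pos)
    \<comment> \<open>Elapsed times up to one period beyond k \<omega> are covered, at the price of
      the factor 1 / r.\<close>
    have r_pow: "r ^ k \<le> exp (- \<alpha> * x) / r" if "x \<le> (real k + 1) * \<omega>" for k x
    proof -
      have "r ^ Suc k = exp (real (Suc k) * ln r)" using r by (simp only: exp_of_nat_mult exp_ln)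
      also have "real (Suc k) * ln r = - \<alpha> * ((real k + 1) * \<omega>)" using assms(4) by (simp add: \<alpha>_def)
      also have "exp \<dots> \<le> exp (- \<alpha> * x)" using that \<alpha> by simp
      finally show ?thesis using r by (simp add: field_simps)
    qed
    \<comment> \<open>One \<open>D\<close> for each end within a period, \<open>B / r\<close> for
      the power in between, and 1 for positivity.\<close>
    define K where "K = D * B * D / r + 1"
    have "K > 0" using \<open>D \<ge> 0\<close> B r by (auto simp: K_def intro: add_nonneg_pos)
    have bound: "op_norm (V t ** X ** matrix_inv (V s)) \<le> K * exp (- \<alpha> * x)"
      if "t \<in> {0..\<omega>}" "s \<in> {0..\<omega>}" "op_norm X \<le> B * r ^ k" "x \<le> (real k + 1) * \<omega>" for t s X k x
    proof -
      have "op_norm (V t ** X ** matrix_inv (V s)) \<le> op_norm (V t) * op_norm X * op_norm (matrix_inv (V s))"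
        by (rule order_trans[OF op_norm_mult]) (intro mult_right_mono op_norm_mult op_norm_nonneg)
      also have "\<dots> \<le> D * (B * r ^ k) * D"
        using D that(1-3) \<open>D \<ge> 0\<close> B r by (intro mult_mono mult_nonneg_nonneg) (auto simp: op_norm_nonneg)
      also have "\<dots> \<le> D * (B * (exp (- \<alpha> * x) / r)) * D"
        using r_pow[OF that(4)] \<open>D \<ge> 0\<close> B by (intro mult_right_mono mult_left_mono) auto
      also have "\<dots> \<le> K * exp (- \<alpha> * x)" by (simp add: K_def algebra_simps)
      finally show ?thesis .
    qed
    have stable: "op_norm (V t ** P ** matrix_inv (V s)) \<le> K * exp (- \<alpha> * (t - s))" if "t \<ge> s" for t s
    proof -
      \<comment> \<open>Both times are moved so that \<open>s\<close> falls into the first period.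
        Then t >= s leaves a nonnegative number k of periods in \<open>t\<close>, and t - s <= (k +
        1) \<omega>.\<close>
      obtain l y where s: "s = y + of_int l * \<omega>" "0 \<le> y" "y < \<omega>" by (rule real_div_period[OF assms(4)])
      have "0 \<le> t - of_int l * \<omega>" using s that by simp
      then obtain k z where z: "t - of_int l * \<omega> = z + of_nat k * \<omega>" "0 \<le> z" "z < \<omega>"
        by (rule nonneg_real_div_period[OF assms(4)])
      have t: "t = (z + of_nat k * \<omega>) + of_int l * \<omega>" using z(1) by simp
      have "V t ** P ** matrix_inv (V s) = V z ** (mpow M k ** P) ** matrix_inv (V y)"
        using G[OF P(2), of "z + of_nat k * \<omega>" l y]
        unfolding t[symmetric] s(1)[symmetric] unfolding G_def shift_pow by (simp add: matrix_mul_assoc)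
      also have "op_norm \<dots> \<le> K * exp (- \<alpha> * (t - s))"
        by (rule bound[OF _ _ st]) (use s z t in \<open>auto simp: algebra_simps\<close>)
      finally show ?thesis .
    qed
    have unstable: "op_norm (V t ** (mat 1 - P) ** matrix_inv (V s)) \<le> K * exp (- \<alpha> * (s - t))"
      if "s \<ge> t" for t s
    proof -
      \<comment> \<open>Here the earlier time \<open>t\<close> is moved to the first period. The
        powers now arise from the inverse of V(s), as N^k to the right of \<open>Q\<close>, and must
        be commuted past \<open>Q\<close> to match \<open>un\<close>.\<close>
      obtain l y where t: "t = y + of_int l * \<omega>" "0 \<le> y" "y < \<omega>" by (rule real_div_period[OF assms(4)])
      have "0 \<le> s - of_int l * \<omega>" using t that by simp
      then obtain k z where z: "s - of_int l * \<omega> = z + of_nat k * \<omega>" "0 \<le> z" "z < \<omega>"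
        by (rule nonneg_real_div_period[OF assms(4)])
      have s: "s = (z + of_nat k * \<omega>) + of_int l * \<omega>" using z(1) by simp
      have "invertible (mpow M k)"
        using mpow_inverse[OF NM(1)] invertible_left_inverse by blast
      then have "matrix_inv (V (z + of_nat k * \<omega>)) = mpow N k ** matrix_inv (V z)"
        unfolding shift_pow by (simp add: matrix_inv_mult invV inv_mpow)
      then have "V t ** Q ** matrix_inv (V s) = V y ** Q ** (mpow N k ** matrix_inv (V z))"
        using G[OF QM, of y l "z + of_nat k * \<omega>"]
        unfolding s[symmetric] t(1)[symmetric] unfolding G_def by simp
      also have "\<dots> = V y ** (Q ** mpow N k) ** matrix_inv (V z)" by (simp add: matrix_mul_assoc)
      also have "\<dots> = V y ** (mpow N k ** Q) ** matrix_inv (V z)" by (simp only: mpow_commuting[OF QN])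
      also have "op_norm \<dots> \<le> K * exp (- \<alpha> * (s - t))"
        by (rule bound[OF _ _ un[folded Q_def]]) (use s z t in \<open>auto simp: algebra_simps\<close>)
      finally show ?thesis by (simp only: Q_def)
    qed
    show "admits_exponential_dichotomy A"
      unfolding admits_exponential_dichotomy_def
      using U P(1) \<open>K > 0\<close> \<alpha> stable unstable unfolding V_def by blast
  qed
qed

end
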